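(* Let $(X,d)$ be a metric space and let $\omega$ be a non-principal ultrafilter on $\mathbb{N}$. Then the following are equivalent. (i) $(X,d)$ is biLipschitz equivalent to a snowflake. (ii) No $\omega$-limit of $(X,d)$ contains a non-constant rectifiable curve. (iii) No $\omega$-limit of $(X,d)$ contains a non-constant geodesic segment. (iv) There exist an integer $k\ge2$ and reals $\varepsilon,\alpha>0$ such that $(X,d)$ satisfies the $\mathrm{SRA}_k(\varepsilon,\alpha)$ condition. (v) $(X,d)$ is not line-fitting. In particular, each of the conditions (i)–(v) is preserved under biLipschitz equivalence of metric spaces.
   Context: **Snowflakes.** A metric space $(X,d)$ is an $\alpha$-snowflake, $\alpha\in(0,1)$, if there is a metric space $(Y,\rho)$ with $(X,d)=(Y,\rho^\alpha)$; it is a snowflake if it is an $\alpha$-snowflake for some $\alpha\in(0,1)$. A map $f\colon(X,d)\to(Y,d')$ is biLipschitz if there is $C\ge1$ with $C^{-1}d(x,x')\le d'(f(x),f(x'))\le C\,d(x,x')$ for all $x,x'\in X$. Two metric spaces are biLipschitz equivalent if there is a surjective biLipschitz map from one onto the other. **Curves.** A curve is a continuous map $\gamma\colon[0,1]\to X$; its length is $\ell(\gamma)=\sup\sum_{i=0}^{N-1}d(\gamma(t_i),\gamma(t_{i+1}))$ over all partitions $0=t_0<\dots<t_N=1$, $N\in\mathbb{N}$. It is rectifiable if $\ell(\gamma)<\infty$. It is a geodesic (segment) if $d(\gamma(t),\gamma(s))=|t-s|\,d(\gamma(0),\gamma(1))$ for all $t,s\in[0,1]$. **Ultralimits.** A non-principal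 ultrafilter $\omega$ on $\mathbb{N}$ is a non-trivial finitely additive measure on all subsets of $\mathbb{N}$ with values in $\{0,1\}$ that vanishes on finite sets. For a bounded real sequence $(a_n)$, $\omega\text{-}\lim a_n$ is the unique $a\in\mathbb{R}$ with $\omega(\{n:|a_n-a|<\varepsilon\})=1$ for all $\varepsilon>0$; unbounded sequences may have $\omega$-limit $\pm\infty$. Given pointed metric spaces $(X_n,d_n,x_n)$, a sequence $(y_n)$ with $y_n\in X_n$ is $\omega$-admissible if $\omega\text{-}\lim d_n(x_n,y_n)<\infty$. The $\omega$-limit $(X_\omega,d_\omega,x_\omega)$ of $(X_n,d_n,x_n)$ is the set of $\omega$-admissible sequences modulo the relation $\omega\text{-}\lim d_n(y_n,z_n)=0$, with metric $d_\omega([y_n],[z_n])=\omega\text{-}\lim d_n(y_n,z_n)$ and base point $x_\omega=[x_n]$. An $\omega$-limit of a metric space $(X,d)$ is the $\omega$-limit of a sequence $(X,r_nd,x_n)$, where $x_n\in X$ and $r_n>0$ are arbitrary sequences. **$\mathrm{SRA}_k(\varepsilon,\alpha)$ condition.** For an integer $k\ge 2$ and $\varepsilon,\alpha>0$, $(X,d)$ satisfies $\mathrm{SRA}_k(\varepsilon,\alpha)$ if for all $x_1,\dots,x_k\in X$ with $\max_{1\le i\le k-1}d(x_i,x_{i+1})\le(1+\varepsilon)\min_{1\le i\le k-1}d(x_i,x_{i+1})$ one has $\sum_{i=1}^{k-1}d(x_i,x_{i+1})\ge(1+\alpha)\,d(x_1,x_k)$. **Line-fitting.** $(X,d)$ is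 line-fitting if for every integer $n\ge1$ there is a metric $d_n$ on the disjoint union $X\sqcup[0,1]$ such that: the restriction of $d_n$ to $[0,1]$ is the Euclidean metric; the restriction of $d_n$ to $X$ is $c_nd$ for some constant $c_n>0$; and every point of $[0,1]$ is at $d_n$-distance less than $\frac1n$ from some point of $X$. *)

theory Defs
  imports "HOL-Analysis.Analysis"
begin

text \<open>
  A metric space is a carrier set together with a distance function, subject to the library
  predicate \<^const>\<open>Metric_space\<close>. In particular the carrier may be empty.
\<close>

section \<open>Snowflakes and biLipschitz maps\<close>

text \<open>The spaces \<open>(X, d)\<close> and \<open>(Y, \<rho> powr \<alpha>)\<close> being equal, \<open>Y\<close> has the carrier \<open>X\<close>.\<close>

definition alpha_snowflake :: "real \<Rightarrow> 'a set \<Rightarrow> ('a \<Rightarrow> 'a \<Rightarrow> real) \<Rightarrow> bool" where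
  "alpha_snowflake \<alpha> X d \<longleftrightarrow>
     (\<exists>\<rho>. Metric_space X \<rho> \<and> (\<forall>x\<in>X. \<forall>y\<in>X. d x y = \<rho> x y powr \<alpha>))"

definition snowflake :: "'a set \<Rightarrow> ('a \<Rightarrow> 'a \<Rightarrow> real) \<Rightarrow> bool" where
  "snowflake X d \<longleftrightarrow> (\<exists>\<alpha>. 0 < \<alpha> \<and> \<alpha> < 1 \<and> alpha_snowflake \<alpha> X d)"

definition bilipschitz_map ::
  "'a set \<Rightarrow> ('a \<Rightarrow> 'a \<Rightarrow> real) \<Rightarrow> 'b set \<Rightarrow> ('b \<Rightarrow> 'b \<Rightarrow> real) \<Rightarrow> ('a \<Rightarrow> 'b) \<Rightarrow> bool" where
  "bilipschitz_map X d Y d' f \<longleftrightarrow>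
     f ` X \<subseteq> Y \<and>
     (\<exists>C\<ge>1. \<forall>x\<in>X. \<forall>x'\<in>X. inverse C * d x x' \<le> d' (f x) (f x') \<and> d' (f x) (f x') \<le> C * d x x')"

definition bilipschitz_equivalent ::
  "'a set \<Rightarrow> ('a \<Rightarrow> 'a \<Rightarrow> real) \<Rightarrow> 'b set \<Rightarrow> ('b \<Rightarrow> 'b \<Rightarrow> real) \<Rightarrow> bool" where
  "bilipschitz_equivalent X d Y d' \<longleftrightarrow> (\<exists>f. bilipschitz_map X d Y d' f \<and> f ` X = Y)"

text \<open>
  A biLipschitz map is injective, so a space biLipschitz equivalent to \<open>X\<close> is in bijection with
  \<open>X\<close> and has an isometric copy with carrier in the type of \<open>X\<close>. Letting \<open>Y\<close> range over sets of
  that type only is therefore no restriction.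
\<close>

definition bilipschitz_equivalent_to_snowflake :: "'a set \<Rightarrow> ('a \<Rightarrow> 'a \<Rightarrow> real) \<Rightarrow> bool" where
  "bilipschitz_equivalent_to_snowflake X d \<longleftrightarrow>
     (\<exists>(Y :: 'a set) d'. Metric_space Y d' \<and> snowflake Y d' \<and> bilipschitz_equivalent X d Y d')"

section \<open>Curves\<close>

text \<open>A curve in \<open>(X, d)\<close> is a \<open>\<gamma>\<close> with \<^term>\<open>pathin (Metric_space.mtopology X d) \<gamma>\<close>.\<close>

definition curve_length :: "('a \<Rightarrow> 'a \<Rightarrow> real) \<Rightarrow> (real \<Rightarrow> 'a) \<Rightarrow> ereal" where
  "curve_length d \<gamma> =
     Sup {ereal (\<Sum>i<N. d (\<gamma> (t i)) (\<gamma> (t (Suc i)))) | (N :: nat) (t :: nat \<Rightarrow> real).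
            t 0 = 0 \<and> t N = 1 \<and> (\<forall>i<N. t i < t (Suc i))}"

definition rectifiable_curve :: "'a set \<Rightarrow> ('a \<Rightarrow> 'a \<Rightarrow> real) \<Rightarrow> (real \<Rightarrow> 'a) \<Rightarrow> bool" where
  "rectifiable_curve X d \<gamma> \<longleftrightarrow> pathin (Metric_space.mtopology X d) \<gamma> \<and> curve_length d \<gamma> < \<infinity>"

definition geodesic_segment :: "'a set \<Rightarrow> ('a \<Rightarrow> 'a \<Rightarrow> real) \<Rightarrow> (real \<Rightarrow> 'a) \<Rightarrow> bool" where
  "geodesic_segment X d \<gamma> \<longleftrightarrow>
     pathin (Metric_space.mtopology X d) \<gamma> \<and>
     (\<forall>t\<in>{0..1}. \<forall>s\<in>{0..1}. d (\<gamma> t) (\<gamma> s) = \<bar>t - s\<bar> * d (\<gamma> 0) (\<gamma> 1))"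

definition nonconstant_curve :: "(real \<Rightarrow> 'a) \<Rightarrow> bool" where
  "nonconstant_curve \<gamma> \<longleftrightarrow> (\<exists>s\<in>{0..1}. \<exists>t\<in>{0..1}. \<gamma> s \<noteq> \<gamma> t)"

section \<open>Ultralimits\<close>

definition nonprincipal_ultrafilter :: "(nat set \<Rightarrow> real) \<Rightarrow> bool" where
  "nonprincipal_ultrafilter \<omega> \<longleftrightarrow>
     (\<forall>A. \<omega> A \<in> {0, 1}) \<and>
     (\<forall>A B. A \<inter> B = {} \<longrightarrow> \<omega> (A \<union> B) = \<omega> A + \<omega> B) \<and>
     (\<exists>A. \<omega> A \<noteq> 0) \<and>
     (\<forall>A. finite A \<longrightarrow> \<omega> A = 0)"

definition has_omega_lim :: "(nat set \<Rightarrow> real) \<Rightarrow> (nat \<Rightarrow> real) \<Rightarrow> ereal \<Rightarrow> bool" where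
  "has_omega_lim \<omega> a l \<longleftrightarrow>
     (case l of
        ereal r \<Rightarrow> \<forall>\<epsilon>>0. \<omega> {n. \<bar>a n - r\<bar> < \<epsilon>} = 1
      | PInfty \<Rightarrow> \<forall>K. \<omega> {n. a n > K} = 1
      | MInfty \<Rightarrow> \<forall>K. \<omega> {n. a n < K} = 1)"

definition omega_lim :: "(nat set \<Rightarrow> real) \<Rightarrow> (nat \<Rightarrow> real) \<Rightarrow> ereal" where
  "omega_lim \<omega> a = (THE l. has_omega_lim \<omega> a l)"

definition omega_admissible ::
  "(nat set \<Rightarrow> real) \<Rightarrow> (nat \<Rightarrow> 'a set) \<Rightarrow> (nat \<Rightarrow> 'a \<Rightarrow> 'a \<Rightarrow> real) \<Rightarrow> (nat \<Rightarrow> 'a) \<Rightarrow> (nat \<Rightarrow> 'a) set" where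
  "omega_admissible \<omega> X d x =
     {y. (\<forall>n. y n \<in> X n) \<and> omega_lim \<omega> (\<lambda>n. d n (x n) (y n)) < \<infinity>}"

definition omega_rel ::
  "(nat set \<Rightarrow> real) \<Rightarrow> (nat \<Rightarrow> 'a set) \<Rightarrow> (nat \<Rightarrow> 'a \<Rightarrow> 'a \<Rightarrow> real) \<Rightarrow> (nat \<Rightarrow> 'a)
     \<Rightarrow> ((nat \<Rightarrow> 'a) \<times> (nat \<Rightarrow> 'a)) set" where
  "omega_rel \<omega> X d x =
     {(y, z). y \<in> omega_admissible \<omega> X d x \<and> z \<in> omega_admissible \<omega> X d x \<and>
              omega_lim \<omega> (\<lambda>n. d n (y n) (z n)) = 0}"

definition omega_limit_space ::
  "(nat set \<Rightarrow> real) \<Rightarrow> (nat \<Rightarrow> 'a set) \<Rightarrow> (nat \<Rightarrow> 'a \<Rightarrow> 'a \<Rightarrow> real) \<Rightarrow> (nat \<Rightarrow> 'a) \<Rightarrow> (nat \<Rightarrow> 'a) set set" where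
  "omega_limit_space \<omega> X d x = omega_admissible \<omega> X d x // omega_rel \<omega> X d x"

text \<open>
  The arguments are equivalence classes; by \<open>omega_limit_dist_classes\<close> below the choice of
  representatives is immaterial.
\<close>

definition omega_limit_dist ::
  "(nat set \<Rightarrow> real) \<Rightarrow> (nat \<Rightarrow> 'a \<Rightarrow> 'a \<Rightarrow> real) \<Rightarrow> (nat \<Rightarrow> 'a) set \<Rightarrow> (nat \<Rightarrow> 'a) set \<Rightarrow> real" where
  "omega_limit_dist \<omega> d A B =
     real_of_ereal (omega_lim \<omega> (\<lambda>n. d n ((SOME y. y \<in> A) n) ((SOME z. z \<in> B) n)))"

text \<open>Base points play no role in the conditions below, so they are dropped from the limit.\<close>

definition is_omega_limit_of ::
  "(nat set \<Rightarrow> real) \<Rightarrow> 'a set \<Rightarrow> ('a \<Rightarrow> 'a \<Rightarrow> real)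
     \<Rightarrow> (nat \<Rightarrow> 'a) set set \<Rightarrow> ((nat \<Rightarrow> 'a) set \<Rightarrow> (nat \<Rightarrow> 'a) set \<Rightarrow> real) \<Rightarrow> bool" where
  "is_omega_limit_of \<omega> X d Z D \<longleftrightarrow>
     (\<exists>(r :: nat \<Rightarrow> real) (x :: nat \<Rightarrow> 'a).
        (\<forall>n. r n > 0) \<and> (\<forall>n. x n \<in> X) \<and>
        Z = omega_limit_space \<omega> (\<lambda>n. X) (\<lambda>n y z. r n * d y z) x \<and>
        D = omega_limit_dist \<omega> (\<lambda>n y z. r n * d y z))"

definition no_omega_limit_contains_rectifiable_curve ::
  "(nat set \<Rightarrow> real) \<Rightarrow> 'a set \<Rightarrow> ('a \<Rightarrow> 'a \<Rightarrow> real) \<Rightarrow> bool" where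
  "no_omega_limit_contains_rectifiable_curve \<omega> X d \<longleftrightarrow>
     (\<forall>Z D. is_omega_limit_of \<omega> X d Z D \<longrightarrow>
        \<not> (\<exists>\<gamma>. rectifiable_curve Z D \<gamma> \<and> nonconstant_curve \<gamma>))"

definition no_omega_limit_contains_geodesic ::
  "(nat set \<Rightarrow> real) \<Rightarrow> 'a set \<Rightarrow> ('a \<Rightarrow> 'a \<Rightarrow> real) \<Rightarrow> bool" where
  "no_omega_limit_contains_geodesic \<omega> X d \<longleftrightarrow>
     (\<forall>Z D. is_omega_limit_of \<omega> X d Z D \<longrightarrow>
        \<not> (\<exists>\<gamma>. geodesic_segment Z D \<gamma> \<and> nonconstant_curve \<gamma>))"

section \<open>The SRA condition and line-fitting\<close>

definition SRA :: "nat \<Rightarrow> real \<Rightarrow> real \<Rightarrow> 'a set \<Rightarrow> ('a \<Rightarrow> 'a \<Rightarrow> real) \<Rightarrow> bool" where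
  "SRA k \<epsilon> \<alpha> X d \<longleftrightarrow>
     (\<forall>x :: nat \<Rightarrow> 'a.
        (\<forall>i\<in>{1..k}. x i \<in> X) \<longrightarrow>
        Max ((\<lambda>i. d (x i) (x (i + 1))) ` {1..k - 1})
          \<le> (1 + \<epsilon>) * Min ((\<lambda>i. d (x i) (x (i + 1))) ` {1..k - 1}) \<longrightarrow>
        (\<Sum>i = 1..k - 1. d (x i) (x (i + 1))) \<ge> (1 + \<alpha>) * d (x 1) (x k))"

definition SRA_for_some :: "'a set \<Rightarrow> ('a \<Rightarrow> 'a \<Rightarrow> real) \<Rightarrow> bool" where
  "SRA_for_some X d \<longleftrightarrow> (\<exists>k \<epsilon> \<alpha>. k \<ge> 2 \<and> \<epsilon> > 0 \<and> \<alpha> > 0 \<and> SRA k \<epsilon> \<alpha> X d)"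

definition line_fitting :: "'a set \<Rightarrow> ('a \<Rightarrow> 'a \<Rightarrow> real) \<Rightarrow> bool" where
  "line_fitting X d \<longleftrightarrow>
     (\<forall>n :: nat. n \<ge> 1 \<longrightarrow>
        (\<exists>(D :: 'a + real \<Rightarrow> 'a + real \<Rightarrow> real) (c :: real).
           Metric_space (X <+> {0..1}) D \<and>
           (\<forall>s\<in>{0..1}. \<forall>t\<in>{0..1}. D (Inr s) (Inr t) = \<bar>s - t\<bar>) \<and>
           c > 0 \<and> (\<forall>x\<in>X. \<forall>y\<in>X. D (Inl x) (Inl y) = c * d x y) \<and>
           (\<forall>t\<in>{0..1}. \<exists>x\<in>X. D (Inr t) (Inl x) < 1 / real n)))"

section \<open>Well-definedness of ultralimits\<close>

context
  fixes \<omega> :: "nat set \<Rightarrow> real"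
  assumes \<omega>: "nonprincipal_ultrafilter \<omega>"
begin

lemma omega_01: "\<omega> A = 0 \<or> \<omega> A = 1"
  using \<omega> unfolding nonprincipal_ultrafilter_def by blast

lemma omega_add: "A \<inter> B = {} \<Longrightarrow> \<omega> (A \<union> B) = \<omega> A + \<omega> B"
  using \<omega> unfolding nonprincipal_ultrafilter_def by blast

lemma omega_empty: "\<omega> {} = 0"
  using \<omega> unfolding nonprincipal_ultrafilter_def by blast

lemma omega_mono: "A \<subseteq> B \<Longrightarrow> \<omega> A = 1 \<Longrightarrow> \<omega> B = 1"
  using omega_add[of A "B - A"] omega_01[of B] omega_01[of "B - A"] by (auto simp: Un_absorb1)

lemma omega_UNIV: "\<omega> UNIV = 1"
proof -
  obtain A where "\<omega> A \<noteq> 0" using \<omega> unfolding nonprincipal_ultrafilter_def by blast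
  then show ?thesis using omega_01[of A] omega_mono[of A UNIV] by auto
qed

lemma omega_Compl: "\<omega> A = 1 \<longleftrightarrow> \<omega> (- A) \<noteq> 1"
  using omega_add[of A "- A"] omega_UNIV omega_01[of A] omega_01[of "- A"]
  by (auto simp: Compl_partition)

lemma omega_Int: "\<omega> A = 1 \<Longrightarrow> \<omega> B = 1 \<Longrightarrow> \<omega> (A \<inter> B) = 1"
proof (rule ccontr)
  assume A: "\<omega> A = 1" and B: "\<omega> B = 1" and "\<omega> (A \<inter> B) \<noteq> 1"
  then have "\<omega> (A \<inter> B) = 0" using omega_01 by blast
  moreover have "\<omega> A = \<omega> (A \<inter> B) + \<omega> (A - B)"
    using omega_add[of "A \<inter> B" "A - B"] by (metis Diff_disjoint Int_Diff_Un Int_assoc Int_commute inf_bot_right Diff_Int_distrib)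
  ultimately have "\<omega> (A - B) = 1" using A by simp
  then have "\<omega> (- B) = 1" using omega_mono[of "A - B" "- B"] by auto
  then show False using B omega_Compl by blast
qed

lemma omega_ex: "\<omega> {n. P n} = 1 \<Longrightarrow> \<exists>n. P n"
  using omega_empty by (metis (full_types) Collect_empty_eq zero_neq_one)

lemma omega_conj: "\<omega> {n. P n} = 1 \<Longrightarrow> \<omega> {n. Q n} = 1 \<Longrightarrow> \<omega> {n. P n \<and> Q n} = 1"
  using omega_Int[of "{n. P n}" "{n. Q n}"] by (simp add: Collect_conj_eq)

lemma omega_imp: "\<omega> {n. P n} = 1 \<Longrightarrow> (\<And>n. P n \<Longrightarrow> Q n) \<Longrightarrow> \<omega> {n. Q n} = 1"
  using omega_mono[of "{n. P n}" "{n. Q n}"] by auto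

lemma omega_not: "\<omega> {n. \<not> P n} = 1 \<longleftrightarrow> \<omega> {n. P n} \<noteq> 1"
  using omega_Compl[of "{n. P n}"] by (auto simp: Collect_neg_eq)

lemma has_omega_lim_less:
  assumes "has_omega_lim \<omega> a l" "ereal u < l" shows "\<omega> {n. u < a n} = 1"
proof (cases l)
  case (real r)
  then have "\<omega> {n. \<bar>a n - r\<bar> < r - u} = 1"
    using assms by (auto simp: has_omega_lim_def)
  then show ?thesis by (rule omega_imp) linarith
qed (use assms in \<open>auto simp: has_omega_lim_def\<close>)

lemma has_omega_lim_greater:
  assumes "has_omega_lim \<omega> a l" "l < ereal u" shows "\<omega> {n. a n < u} = 1"
proof (cases l)
  case (real r)
  then have "\<omega> {n. \<bar>a n - r\<bar> < u - r} = 1"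
    using assms by (auto simp: has_omega_lim_def)
  then show ?thesis by (rule omega_imp) linarith
qed (use assms in \<open>auto simp: has_omega_lim_def\<close>)

lemma has_omega_lim_mono:
  assumes "has_omega_lim \<omega> a l" "has_omega_lim \<omega> b m" "\<And>n. a n \<le> b n"
  shows "l \<le> m"
proof (rule ccontr)
  assume "\<not> l \<le> m"
  then have "m < l" by simp
  then obtain u where u: "m < ereal u" "ereal u < l"
    using ereal_dense2 by blast
  have "\<exists>n. u < a n \<and> b n < u"
    by (intro omega_ex omega_conj has_omega_lim_less[OF assms(1) u(2)]
        has_omega_lim_greater[OF assms(2) u(1)])
  then show False using assms(3) by (meson less_le_not_le less_le_trans order.strict_trans)
qed

lemma has_omega_lim_unique:
  "has_omega_lim \<omega> a l \<Longrightarrow> has_omega_lim \<omega> a m \<Longrightarrow> l = m"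
  by (meson antisym has_omega_lim_mono order_refl)

lemma has_omega_lim_ex: "\<exists>l. has_omega_lim \<omega> a l"
proof -
  define l where "l = Sup {ereal u | u. \<omega> {n. u < a n} = 1}"
  have less: "\<omega> {n. u < a n} = 1" if ul: "ereal u < l" for u
  proof -
    obtain v where "\<omega> {n. v < a n} = 1" "u < v"
      using ul less_Sup_iff[of "ereal u" "{ereal u | u. \<omega> {n. u < a n} = 1}"]
      by (auto simp: l_def)
    then show ?thesis by (elim omega_imp) linarith
  qed
  have greater: "\<omega> {n. a n < u} = 1" if lu: "l < ereal u" for u
  proof -
    obtain v where v: "l < ereal v" "ereal v < ereal u" using ereal_dense2[OF lu] by blast
    have "\<omega> {n. v < a n} \<noteq> 1"
    proof
      assume "\<omega> {n. v < a n} = 1"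
      then have "ereal v \<le> l" unfolding l_def by (intro Sup_upper) auto
      then show False using v by simp
    qed
    then have "\<omega> {n. \<not> v < a n} = 1" using omega_not[of "\<lambda>n. v < a n"] by simp
    then show ?thesis using v by (elim omega_imp) auto
  qed
  have "has_omega_lim \<omega> a l"
  proof (cases l)
    case (real r)
    have "\<omega> {n. \<bar>a n - r\<bar> < e} = 1" if "e > 0" for e
    proof -
      have "\<omega> {n. r - e < a n \<and> a n < r + e} = 1"
        using that real by (intro omega_conj less greater) auto
      then show ?thesis by (rule omega_imp) linarith
    qed
    then show ?thesis using real by (simp add: has_omega_lim_def)
  qed (auto simp: has_omega_lim_def less greater)
  then show ?thesis by blast
qed

lemma omega_lim_eq_iff: "omega_lim \<omega> a = l \<longleftrightarrow> has_omega_lim \<omega> a l"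
  unfolding omega_lim_def
  by (metis has_omega_lim_ex has_omega_lim_unique the_equality)

lemma has_omega_lim_omega_lim: "has_omega_lim \<omega> a (omega_lim \<omega> a)"
  using omega_lim_eq_iff by blast

lemma omega_lim_const: "omega_lim \<omega> (\<lambda>n. c) = ereal c"
  unfolding omega_lim_eq_iff using omega_UNIV by (simp add: has_omega_lim_def)

lemma omega_lim_mono: "(\<And>n. a n \<le> b n) \<Longrightarrow> omega_lim \<omega> a \<le> omega_lim \<omega> b"
  by (meson has_omega_lim_mono has_omega_lim_omega_lim)

lemma omega_lim_nonneg: "(\<And>n. 0 \<le> a n) \<Longrightarrow> 0 \<le> omega_lim \<omega> a"
  using omega_lim_mono[of "\<lambda>n. 0" a] omega_lim_const[of 0] by (simp add: zero_ereal_def)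

lemma omega_lim_add:
  assumes "\<And>n. 0 \<le> a n" "\<And>n. 0 \<le> b n"
  shows "omega_lim \<omega> (\<lambda>n. a n + b n) = omega_lim \<omega> a + omega_lim \<omega> b"
proof -
  have inf: "omega_lim \<omega> f = \<infinity> \<Longrightarrow> (\<And>n. f n \<le> g n) \<Longrightarrow> omega_lim \<omega> g = \<infinity>" for f g
    using omega_lim_mono[of f g] by simp
  consider "omega_lim \<omega> a = \<infinity>" | "omega_lim \<omega> b = \<infinity>"
    | A B where "omega_lim \<omega> a = ereal A" "omega_lim \<omega> b = ereal B"
    using omega_lim_nonneg[of a] omega_lim_nonneg[of b] assms
    by (cases "omega_lim \<omega> a"; cases "omega_lim \<omega> b") auto
  then show ?thesis
  proof cases
    case 1
    then show ?thesis using inf[of a "\<lambda>n. a n + b n"] assms by simp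
  next
    case 2
    then show ?thesis using inf[of b "\<lambda>n. a n + b n"] assms by simp
  next
    case 3
    have "\<omega> {n. \<bar>a n + b n - (A + B)\<bar> < e} = 1" if "e > 0" for e
    proof -
      have "\<omega> {n. \<bar>a n - A\<bar> < e / 2 \<and> \<bar>b n - B\<bar> < e / 2} = 1"
        using 3 half_gt_zero[OF that]
        by (intro omega_conj) (simp_all only: omega_lim_eq_iff has_omega_lim_def ereal.case)
      then show ?thesis by (rule omega_imp) linarith
    qed
    then have "omega_lim \<omega> (\<lambda>n. a n + b n) = ereal (A + B)"
      by (simp add: omega_lim_eq_iff has_omega_lim_def)
    then show ?thesis using 3 by simp
  qed
qed

context
  fixes X :: "nat \<Rightarrow> 'a set" and d :: "nat \<Rightarrow> 'a \<Rightarrow> 'a \<Rightarrow> real" and x :: "nat \<Rightarrow> 'a"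
  assumes met: "\<And>n. Metric_space (X n) (d n)" and x: "\<And>n. x n \<in> X n"
begin

private abbreviation "L y z \<equiv> omega_lim \<omega> (\<lambda>n. d n (y n) (z n))"
private abbreviation "Adm \<equiv> omega_admissible \<omega> X d x"

lemma omega_lim_dist_nonneg: "0 \<le> L y z"
  by (intro omega_lim_nonneg Metric_space.nonneg[OF met])

lemma omega_lim_dist_commute: "L y z = L z y"
  using Metric_space.commute[OF met] by presburger

lemma omega_lim_dist_triangle:
  assumes "\<And>n. u n \<in> X n" "\<And>n. v n \<in> X n" "\<And>n. w n \<in> X n"
  shows "L u w \<le> L u v + L v w"
proof -
  have "L u w \<le> omega_lim \<omega> (\<lambda>n. d n (u n) (v n) + d n (v n) (w n))"
    by (intro omega_lim_mono Metric_space.triangle[OF met] assms)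
  then show ?thesis by (simp add: omega_lim_add Metric_space.nonneg[OF met])
qed

lemma omega_admissibleD: "y \<in> Adm \<Longrightarrow> y n \<in> X n"
  by (simp add: omega_admissible_def)

lemma omega_lim_dist_finite:
  assumes "y \<in> Adm" "z \<in> Adm" shows "L y z = ereal (real_of_ereal (L y z))"
proof -
  have "L y z \<le> L y x + L x z"
    using assms x by (intro omega_lim_dist_triangle) (auto simp: omega_admissible_def)
  also have "\<dots> < \<infinity>"
    using assms omega_lim_dist_commute[of y x] by (simp add: omega_admissible_def)
  finally show ?thesis using omega_lim_dist_nonneg[of y z] by (cases "L y z") auto
qed

lemma omega_rel_equiv: "equiv Adm (omega_rel \<omega> X d x)"
proof (rule equivI)
  show "refl_on Adm (omega_rel \<omega> X d x)"
    using omega_admissibleD Metric_space.mdist_zero[OF met] omega_lim_const[of 0]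
    by (auto simp: refl_on_def omega_rel_def zero_ereal_def)
  show "sym (omega_rel \<omega> X d x)"
    by (auto simp: sym_def omega_rel_def) (metis omega_lim_dist_commute)
  show "trans (omega_rel \<omega> X d x)"
  proof (rule transI)
    fix u v w assume uv: "(u, v) \<in> omega_rel \<omega> X d x" and vw: "(v, w) \<in> omega_rel \<omega> X d x"
    then have "L u w \<le> L u v + L v w"
      by (intro omega_lim_dist_triangle) (auto simp: omega_rel_def omega_admissibleD)
    then have "L u w = 0"
      using uv vw omega_lim_dist_nonneg[of u w] by (simp add: omega_rel_def)
    then show "(u, w) \<in> omega_rel \<omega> X d x" using uv vw by (simp add: omega_rel_def)
  qed
qed (auto simp: omega_rel_def)

lemma omega_limit_dist_classes:
  assumes y: "y \<in> Adm" and z: "z \<in> Adm"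
  shows "ereal (omega_limit_dist \<omega> d (omega_rel \<omega> X d x `` {y}) (omega_rel \<omega> X d x `` {z})) = L y z"
proof -
  let ?r = "omega_rel \<omega> X d x"
  define y' z' where "y' = (SOME u. u \<in> ?r `` {y})" and "z' = (SOME u. u \<in> ?r `` {z})"
  have "y' \<in> ?r `` {y}" "z' \<in> ?r `` {z}"
    unfolding y'_def z'_def
    using equiv_class_self[OF omega_rel_equiv y] equiv_class_self[OF omega_rel_equiv z]
    by (metis someI)+
  then have y': "y' \<in> Adm" "L y y' = 0" and z': "z' \<in> Adm" "L z z' = 0"
    by (auto simp: omega_rel_def)
  have "L y' z' \<le> L y' y + L y z'" "L y z' \<le> L y z + L z z'"
       "L y z \<le> L y y' + L y' z" "L y' z \<le> L y' z' + L z' z"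
    by (intro omega_lim_dist_triangle omega_admissibleD y z y'(1) z'(1))+
  then have "L y' z' = L y z"
    using y'(2) z'(2) omega_lim_dist_commute[of y y'] omega_lim_dist_commute[of z z']
    by (intro antisym) (auto intro: order_trans)
  then show ?thesis
    using omega_lim_dist_finite[OF y z]
    unfolding omega_limit_dist_def y'_def[symmetric] z'_def[symmetric] by simp
qed

lemma Metric_space_omega_limit:
  "Metric_space (omega_limit_space \<omega> X d x) (omega_limit_dist \<omega> d)"
proof
  let ?r = "omega_rel \<omega> X d x"
  fix A B C
  have "0 \<le> real_of_ereal (L y z)" for y z
    using omega_lim_dist_nonneg by (simp add: real_of_ereal_pos)
  then show "0 \<le> omega_limit_dist \<omega> d A B"
    by (simp add: omega_limit_dist_def)
  show "omega_limit_dist \<omega> d A B = omega_limit_dist \<omega> d B A"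
    unfolding omega_limit_dist_def by (subst omega_lim_dist_commute) simp
  assume "A \<in> omega_limit_space \<omega> X d x" "B \<in> omega_limit_space \<omega> X d x"
  then obtain y z where y: "y \<in> Adm" "A = ?r `` {y}" and z: "z \<in> Adm" "B = ?r `` {z}"
    unfolding omega_limit_space_def by (metis quotientE)
  have AB: "ereal (omega_limit_dist \<omega> d A B) = L y z"
    unfolding y(2) z(2) by (rule omega_limit_dist_classes[OF y(1) z(1)])
  have "omega_limit_dist \<omega> d A B = 0 \<longleftrightarrow> (y, z) \<in> ?r"
    unfolding omega_rel_def using AB y(1) z(1) by (auto simp: zero_ereal_def simp flip: AB)
  then show "omega_limit_dist \<omega> d A B = 0 \<longleftrightarrow> A = B"
    using eq_equiv_class_iff[OF omega_rel_equiv y(1) z(1)] y(2) z(2) by simp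
  assume "C \<in> omega_limit_space \<omega> X d x"
  then obtain w where w: "w \<in> Adm" "C = ?r `` {w}"
    unfolding omega_limit_space_def by (metis quotientE)
  have BC: "ereal (omega_limit_dist \<omega> d B C) = L z w"
    unfolding z(2) w(2) by (rule omega_limit_dist_classes[OF z(1) w(1)])
  have AC: "ereal (omega_limit_dist \<omega> d A C) = L y w"
    unfolding y(2) w(2) by (rule omega_limit_dist_classes[OF y(1) w(1)])
  have "L y w \<le> L y z + L z w"
    by (intro omega_lim_dist_triangle omega_admissibleD y z w)
  then show "omega_limit_dist \<omega> d A C \<le> omega_limit_dist \<omega> d A B + omega_limit_dist \<omega> d B C"
    by (simp flip: AB BC AC)
qed

end

end

end

theory Submission
  imports Defs
begin

text \<open>
  All five conditions are compared with two intermediate ones, neither of which mentions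
  snowflakes or ultralimits.

  The first one is negative: \<open>X\<close> contains finite chains \<open>x\<^sub>0, \<dots>, x\<^sub>N\<close> that are, up to rescaling,
  arbitrarily close to \<open>N + 1\<close> equally spaced points of the unit interval, for every \<open>N\<close>
  (\<open>contains_almost_geodesic_chains\<close>). Line-fitting gives such chains by moving equally spaced
  points of \<open>[0, 1]\<close> to nearby points of \<open>X\<close>; conversely \<open>[0, 1]\<close> can be glued to \<open>X\<close> along such a
  chain. A chain whose steps are nearly equal and nearly add up to the distance of its ends is
  such a chain by the triangle inequality alone, so this is also the failure of the SRA condition.
  An ultralimit of these chains is a geodesic segment.

  The second one is positive: for some \<open>q > 1\<close> and \<open>K\<close>, every chain satisfies
  \<open>d(x\<^sub>0, x\<^sub>N)\<^sup>q \<le> K \<Sum> d(x\<^sub>i, x\<^sub>i\<^sub>+\<^sub>1)\<^sup>q\<close> (\<open>satisfies_chain_inequality\<close>). It says that the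
  largest pseudometric below \<open>d\<^sup>q\<close> is comparable with \<open>d\<^sup>q\<close>, which means that \<open>X\<close> is biLipschitz
  equivalent to a snowflake. The inequality is inherited by ultralimits, and it excludes
  non-constant rectifiable curves: cutting a curve of length \<open>l\<close> into steps of size at most \<open>e\<close> bounds the
  \<open>q\<close>-th power of the distance of its ends by \<open>K e\<^sup>q\<^sup>-\<^sup>1 l\<close>, which tends to zero with \<open>e\<close>.

  What remains is that a space without almost geodesic chains satisfies the chain inequality
  (\<open>chain_inequality_if_no_almost_geodesic_chains\<close>). If no chain of \<open>N\<close> steps is
  almost geodesic, then \<open>N\<close> steps of size at most \<open>s\<close> never lead further than
  \<open>(1 - \<eta>) N s\<close>. Applying this to chains of chains, \<open>N\<^sup>j\<close> steps never lead further than
  \<open>(1 - \<eta>)\<^sup>j N\<^sup>j s\<close>, a small fraction of the trivial bound. This gain absorbs the loss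
  incurred when an arbitrary chain is cut into at most \<open>N\<^sup>j\<close> pieces, single steps and blocks of
  bounded weight \<open>\<Sum> d(x\<^sub>i, x\<^sub>i\<^sub>+\<^sub>1)\<^sup>q\<close>, and the chain inequality follows by induction on the length of the
  chain. The geodesic in the ultralimit is thus obtained without differentiating rectifiable
  curves.

  Finally, the chain inequality is visibly invariant under biLipschitz maps, so all the
  conditions are.
\<close>

section \<open>Almost geodesic chains\<close>

text \<open>
  After scaling by \<open>c\<close>, the points \<open>x\<^sub>0, \<dots>, x\<^sub>N\<close> sit like \<open>0, 1/N, \<dots>, 1\<close> in the unit
  interval, up to an error \<open>\<eta>\<close> in all distances.
\<close>

definition almost_geodesic_chain ::
  "'a set \<Rightarrow> ('a \<Rightarrow> 'a \<Rightarrow> real) \<Rightarrow> nat \<Rightarrow> real \<Rightarrow> real \<Rightarrow> (nat \<Rightarrow> 'a) \<Rightarrow> bool" where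
  "almost_geodesic_chain X d N \<eta> c x \<longleftrightarrow>
     c > 0 \<and> (\<forall>i\<le>N. x i \<in> X) \<and>
     (\<forall>i\<le>N. \<forall>j\<le>N. \<bar>c * d (x i) (x j) - \<bar>real i - real j\<bar> / real N\<bar> \<le> \<eta>)"

definition contains_almost_geodesic_chains :: "'a set \<Rightarrow> ('a \<Rightarrow> 'a \<Rightarrow> real) \<Rightarrow> bool" where
  "contains_almost_geodesic_chains X d \<longleftrightarrow>
     (\<forall>N\<ge>1. \<forall>\<eta>>0. \<exists>c x. almost_geodesic_chain X d N \<eta> c x)"

lemma dist_le_sum_steps:
  assumes "Metric_space X d" "i \<le> j" "\<And>l. i \<le> l \<Longrightarrow> l \<le> j \<Longrightarrow> x l \<in> X"
  shows "d (x i) (x j) \<le> (\<Sum>l=i..<j. d (x l) (x (Suc l)))"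
  using assms(2,3)
proof (induction j rule: dec_induct)
  case base
  then show ?case using Metric_space.mdist_zero[OF assms(1)] by auto
next
  case (step j)
  have "d (x i) (x (Suc j)) \<le> d (x i) (x j) + d (x j) (x (Suc j))"
    using step by (intro Metric_space.triangle[OF assms(1)]) auto
  then show ?case using step by simp
qed

lemma dist_le_mult_step:
  assumes "Metric_space X d" "i \<le> j" "\<And>l. i \<le> l \<Longrightarrow> l \<le> j \<Longrightarrow> x l \<in> X"
    and "\<And>l. i \<le> l \<Longrightarrow> l < j \<Longrightarrow> d (x l) (x (Suc l)) \<le> s"
  shows "d (x i) (x j) \<le> (real j - real i) * s"
proof -
  have "d (x i) (x j) \<le> (\<Sum>l=i..<j. d (x l) (x (Suc l)))"
    using assms by (intro dist_le_sum_steps) auto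
  also have "\<dots> \<le> (\<Sum>l=i..<j. s)" using assms by (intro sum_mono) auto
  finally show ?thesis using assms(2) by (simp add: of_nat_diff)
qed

text \<open>
  If the ends of a chain are almost as far apart as the number and size of its steps permit, no
  detour is possible anywhere: a deficit of \<open>d(x\<^sub>i, x\<^sub>j)\<close> against \<open>\<bar>i - j\<bar> s\<close> would shorten
  \<open>d(x\<^sub>0, x\<^sub>N)\<close> by the same amount.
\<close>

lemma almost_geodesic_chain_if_extremal:
  assumes M: "Metric_space X d" and N: "N \<ge> 1" and s: "s > 0"
    and x: "\<And>i. i \<le> N \<Longrightarrow> x i \<in> X"
    and step: "\<And>i. i < N \<Longrightarrow> d (x i) (x (Suc i)) \<le> s"
    and long: "d (x 0) (x N) \<ge> (1 - \<eta>) * real N * s" and \<eta>: "0 \<le> \<eta>"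
  shows "almost_geodesic_chain X d N \<eta> (1 / (real N * s)) x"
proof -
  have le: "\<bar>d (x i) (x j) - (real j - real i) * s\<bar> \<le> \<eta> * (N * s)" if ij: "i \<le> j" "j \<le> N" for i j
  proof -
    have up: "d (x a) (x b) \<le> (real b - real a) * s" if "a \<le> b" "b \<le> N" for a b
      using that by (intro dist_le_mult_step[OF M]) (auto intro: x step)
    have "d (x 0) (x N) \<le> d (x 0) (x i) + d (x i) (x j) + d (x j) (x N)"
      using Metric_space.triangle[OF M, of "x 0" "x i" "x N"]
        Metric_space.triangle[OF M, of "x i" "x j" "x N"] x ij by force
    then have "d (x 0) (x N) \<le> (real i - 0) * s + d (x i) (x j) + (real N - real j) * s"
      using up[of 0 i] up[of j N] ij by simp
    moreover have "0 \<le> \<eta> * (N * s)" using \<eta> s by simp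
    ultimately show ?thesis
      using up[of i j] ij long by (simp add: algebra_simps abs_le_iff)
  qed
  have "\<bar>1 / (real N * s) * d (x i) (x j) - \<bar>real i - real j\<bar> / N\<bar> \<le> \<eta>" if ij: "i \<le> N" "j \<le> N" for i j
  proof -
    have "\<bar>d (x i) (x j) - \<bar>real i - real j\<bar> * s\<bar> \<le> \<eta> * (N * s)"
    proof (cases "i \<le> j")
      case True then show ?thesis using le[of i j] ij by simp
    next
      case False then show ?thesis using le[of j i] ij Metric_space.commute[OF M, of "x i" "x j"] by simp
    qed
    moreover have "1 / (real N * s) * d (x i) (x j) - \<bar>real i - real j\<bar> / N
        = (d (x i) (x j) - \<bar>real i - real j\<bar> * s) / (N * s)"
      using N s by (simp add: field_simps)
    ultimately show ?thesis using N s
      by (simp add: abs_mult divide_le_eq pos_divide_le_eq)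
  qed
  then show ?thesis using N s x by (simp add: almost_geodesic_chain_def)
qed

section \<open>The chain inequality\<close>

definition chain_inequality :: "real \<Rightarrow> real \<Rightarrow> 'a set \<Rightarrow> ('a \<Rightarrow> 'a \<Rightarrow> real) \<Rightarrow> bool" where
  "chain_inequality q K X d \<longleftrightarrow>
     (\<forall>N x. (\<forall>i\<le>N. x i \<in> X) \<longrightarrow>
        d (x 0) (x N) powr q \<le> K * (\<Sum>i<N. d (x i) (x (Suc i)) powr q))"

definition satisfies_chain_inequality :: "'a set \<Rightarrow> ('a \<Rightarrow> 'a \<Rightarrow> real) \<Rightarrow> bool" where
  "satisfies_chain_inequality X d \<longleftrightarrow> (\<exists>q>1. \<exists>K>0. chain_inequality q K X d)"

lemma chain_inequality_bilipschitz:
  assumes M: "Metric_space X d" and ch: "chain_inequality q K X d" and q: "q > 0" and K: "K \<ge> 0"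
    and g: "g ` Z \<subseteq> X" and C: "C > 0"
    and low: "\<And>y z. y \<in> Z \<Longrightarrow> z \<in> Z \<Longrightarrow> d (g y) (g z) \<le> C * e y z"
    and up: "\<And>y z. y \<in> Z \<Longrightarrow> z \<in> Z \<Longrightarrow> e y z \<le> C * d (g y) (g z)"
    and Z: "Metric_space Z e"
  shows "chain_inequality q (C powr q * K * C powr q) Z e"
  unfolding chain_inequality_def
proof (intro allI impI)
  fix N and x :: "nat \<Rightarrow> _" assume x: "\<forall>i\<le>N. x i \<in> Z"
  have nn: "0 \<le> d a b" "0 \<le> e y z" for a b y z using M Z by (simp_all add: Metric_space.nonneg)
  have "e (x 0) (x N) powr q \<le> (C * d (g (x 0)) (g (x N))) powr q"
    using x q by (intro powr_mono2 up nn) auto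
  also have "\<dots> = C powr q * d (g (x 0)) (g (x N)) powr q"
    using C nn by (simp add: powr_mult)
  also have "d (g (x 0)) (g (x N)) powr q \<le> K * (\<Sum>i<N. d (g (x i)) (g (x (Suc i))) powr q)"
  proof -
    have "\<forall>i\<le>N. g (x i) \<in> X" using x g by auto
    then show ?thesis using ch unfolding chain_inequality_def by (auto dest: spec[of _ "\<lambda>i. g (x i)"])
  qed
  also have "(\<Sum>i<N. d (g (x i)) (g (x (Suc i))) powr q) \<le> (\<Sum>i<N. C powr q * e (x i) (x (Suc i)) powr q)"
  proof (intro sum_mono)
    fix i assume "i \<in> {..<N}"
    then have "d (g (x i)) (g (x (Suc i))) powr q \<le> (C * e (x i) (x (Suc i))) powr q"
      using x q by (intro powr_mono2 low nn) auto
    then show "d (g (x i)) (g (x (Suc i))) powr q \<le> C powr q * e (x i) (x (Suc i)) powr q"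
      using C nn by (simp add: powr_mult)
  qed
  finally show "e (x 0) (x N) powr q \<le> C powr q * K * C powr q * (\<Sum>i<N. e (x i) (x (Suc i)) powr q)"
    using K by (simp add: mult_left_mono mult.assoc flip: sum_distrib_left)
qed

lemma satisfies_chain_inequality_bilipschitz_equivalent:
  assumes X: "Metric_space X d" and Y: "Metric_space Y e" and eq: "bilipschitz_equivalent X d Y e"
  shows "satisfies_chain_inequality X d \<longleftrightarrow> satisfies_chain_inequality Y e"
proof -
  obtain f C where f: "f ` X = Y" and C: "C \<ge> 1"
    and bl: "\<And>x y. x \<in> X \<Longrightarrow> y \<in> X \<Longrightarrow> inverse C * d x y \<le> e (f x) (f y) \<and> e (f x) (f y) \<le> C * d x y"
    using eq unfolding bilipschitz_equivalent_def bilipschitz_map_def by blast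
  have low: "d x y \<le> C * e (f x) (f y)" if "x \<in> X" "y \<in> X" for x y
    using bl[OF that] C by (simp add: field_simps)
  define g where "g = inv_into X f"
  have g: "g y \<in> X" "f (g y) = y" if "y \<in> Y" for y
    using that f by (auto simp: g_def inv_into_into f_inv_into_f)
  have pos: "C powr q * K * C powr q > 0" if "K > 0" for q K :: real
    using that C by simp
  show ?thesis
  proof
    assume "satisfies_chain_inequality X d"
    then obtain q K where q: "q > 1" "K > 0" and ch: "chain_inequality q K X d"
      by (auto simp: satisfies_chain_inequality_def)
    have "chain_inequality q (C powr q * K * C powr q) Y e"
    proof (rule chain_inequality_bilipschitz[OF X ch _ _ _ _ _ _ Y])
      fix y z assume "y \<in> Y" "z \<in> Y"
      then show "d (g y) (g z) \<le> C * e y z" "e y z \<le> C * d (g y) (g z)"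
        using low[of "g y" "g z"] bl[of "g y" "g z"] g by auto
    qed (use q C g in auto)
    then show "satisfies_chain_inequality Y e"
      using q pos by (auto simp: satisfies_chain_inequality_def)
  next
    assume "satisfies_chain_inequality Y e"
    then obtain q K where q: "q > 1" "K > 0" and ch: "chain_inequality q K Y e"
      by (auto simp: satisfies_chain_inequality_def)
    have "chain_inequality q (C powr q * K * C powr q) X d"
      using q C f low bl
      by (intro chain_inequality_bilipschitz[OF Y ch _ _ _ _ _ _ X, of f]) auto
    then show "satisfies_chain_inequality X d"
      using q pos by (auto simp: satisfies_chain_inequality_def)
  qed
qed

text \<open>If \<open>d = \<rho>\<^sup>\<alpha>\<close>, the chain inequality with exponent \<open>1 / \<alpha>\<close> is the triangle inequality of \<open>\<rho>\<close>.\<close>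

lemma satisfies_chain_inequality_snowflake:
  assumes "Metric_space Y e" and "snowflake Y e"
  shows "satisfies_chain_inequality Y e"
proof -
  obtain \<alpha> \<rho> where \<alpha>: "0 < \<alpha>" "\<alpha> < 1" and \<rho>: "Metric_space Y \<rho>"
    and e: "\<And>x y. x \<in> Y \<Longrightarrow> y \<in> Y \<Longrightarrow> e x y = \<rho> x y powr \<alpha>"
    using assms(2) by (auto simp: snowflake_def alpha_snowflake_def)
  have pw: "e x y powr (1 / \<alpha>) = \<rho> x y" if "x \<in> Y" "y \<in> Y" for x y
    using e[OF that] \<alpha> Metric_space.nonneg[OF \<rho>] by (simp add: powr_powr)
  have "chain_inequality (1 / \<alpha>) 1 Y e"
    unfolding chain_inequality_def
  proof (intro allI impI)
    fix N and x :: "nat \<Rightarrow> _" assume x: "\<forall>i\<le>N. x i \<in> Y"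
    have "\<rho> (x 0) (x N) \<le> (\<Sum>i=0..<N. \<rho> (x i) (x (Suc i)))"
      using x by (intro dist_le_sum_steps[OF \<rho>]) auto
    then show "e (x 0) (x N) powr (1 / \<alpha>) \<le> 1 * (\<Sum>i<N. e (x i) (x (Suc i)) powr (1 / \<alpha>))"
      using x by (simp add: pw atLeast0LessThan)
  qed
  then show ?thesis unfolding satisfies_chain_inequality_def using \<alpha>
    by (intro exI[of _ "1 / \<alpha>"] conjI exI[of _ 1]) auto
qed

definition chain_sums :: "real \<Rightarrow> 'a set \<Rightarrow> ('a \<Rightarrow> 'a \<Rightarrow> real) \<Rightarrow> 'a \<Rightarrow> 'a \<Rightarrow> real set" where
  "chain_sums q X d a b =
     {\<Sum>i<N. d (x i) (x (Suc i)) powr q |N x. x 0 = a \<and> x N = b \<and> (\<forall>i\<le>N. x i \<in> X)}"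

text \<open>
  The largest pseudometric on \<open>X\<close> below \<open>d\<^sup>q\<close>. The value outside \<open>X\<close> is fixed because \<^const>\<open>Metric_space\<close>
  demands symmetry and nonnegativity on the whole type.
\<close>

definition chain_metric :: "real \<Rightarrow> 'a set \<Rightarrow> ('a \<Rightarrow> 'a \<Rightarrow> real) \<Rightarrow> 'a \<Rightarrow> 'a \<Rightarrow> real" where
  "chain_metric q X d a b = (if a \<in> X \<and> b \<in> X then Inf (chain_sums q X d a b) else 0)"

lemma chain_sums_nonneg: "s \<in> chain_sums q X d a b \<Longrightarrow> 0 \<le> s"
  by (auto simp: chain_sums_def intro!: sum_nonneg)

lemma bdd_below_chain_sums: "bdd_below (chain_sums q X d a b)"
  using chain_sums_nonneg by (metis bdd_belowI)

lemma single_step_in_chain_sums: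
  assumes "a \<in> X" "b \<in> X" shows "d a b powr q \<in> chain_sums q X d a b"
  unfolding chain_sums_def mem_Collect_eq
  using assms by (intro exI[of _ 1] exI[of _ "\<lambda>i. if i = 0 then a else b"]) auto

lemma chain_sums_nonempty: "a \<in> X \<Longrightarrow> b \<in> X \<Longrightarrow> chain_sums q X d a b \<noteq> {}"
  using single_step_in_chain_sums by fastforce

lemma chain_sums_add:
  assumes "s \<in> chain_sums q X d a b" "t \<in> chain_sums q X d b c"
  shows "s + t \<in> chain_sums q X d a c"
proof -
  obtain M x where x: "x 0 = a" "x M = b" "\<And>i. i \<le> M \<Longrightarrow> x i \<in> X"
    and s: "s = (\<Sum>i<M. d (x i) (x (Suc i)) powr q)"
    using assms(1) unfolding chain_sums_def by blast
  obtain N y where y: "y 0 = b" "y N = c" "\<And>i. i \<le> N \<Longrightarrow> y i \<in> X"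
    and t: "t = (\<Sum>i<N. d (y i) (y (Suc i)) powr q)"
    using assms(2) unfolding chain_sums_def by blast
  define z where "z i = (if i \<le> M then x i else y (i - M))" for i
  have zx: "z i = x i" if "i \<le> M" for i using that by (simp add: z_def)
  have zy: "z (i + M) = y i" for i using x y by (simp add: z_def)
  have "(\<Sum>i<N + M. d (z i) (z (Suc i)) powr q)
      = (\<Sum>i=0..<M. d (z i) (z (Suc i)) powr q) + (\<Sum>i=0+M..<N + M. d (z i) (z (Suc i)) powr q)"
    using sum.atLeastLessThan_concat[of 0 M "N + M" "\<lambda>i. d (z i) (z (Suc i)) powr q"]
    by (simp add: atLeast0LessThan)
  also have "(\<Sum>i=0..<M. d (z i) (z (Suc i)) powr q) = s"
    unfolding s atLeast0LessThan by (intro sum.cong) (auto simp: zx)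
  also have "(\<Sum>i=0+M..<N + M. d (z i) (z (Suc i)) powr q) = t"
    unfolding t sum.shift_bounds_nat_ivl atLeast0LessThan
    using zy[of "Suc _"] by (intro sum.cong) (auto simp: zy)
  finally have "s + t = (\<Sum>i<N + M. d (z i) (z (Suc i)) powr q)" by simp
  moreover have "z i \<in> X" if "i \<le> N + M" for i
    using that x(3) y(3)[of "i - M"] by (auto simp: z_def)
  moreover have "z 0 = a" "z (N + M) = c" using x y zy by (auto simp: z_def)
  ultimately show ?thesis unfolding chain_sums_def by blast
qed

lemma chain_sums_commute:
  assumes M: "Metric_space X d"
  shows "chain_sums q X d a b = chain_sums q X d b a"
proof -
  have "chain_sums q X d a b \<subseteq> chain_sums q X d b a" for a b
  proof
    fix s assume "s \<in> chain_sums q X d a b"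
    then obtain N x where x: "x 0 = a" "x N = b" "\<And>i. i \<le> N \<Longrightarrow> x i \<in> X"
      and s: "s = (\<Sum>i<N. d (x i) (x (Suc i)) powr q)"
      unfolding chain_sums_def by blast
    have "s = (\<Sum>i<N. d (x (N - Suc i)) (x (Suc (N - Suc i))) powr q)"
      unfolding s by (rule sum.nat_diff_reindex[symmetric])
    also have "\<dots> = (\<Sum>i<N. d (x (N - i)) (x (N - Suc i)) powr q)"
      using Metric_space.commute[OF M] by (intro sum.cong) (auto simp: Suc_diff_Suc)
    finally show "s \<in> chain_sums q X d b a"
      unfolding chain_sums_def mem_Collect_eq using x
      by (intro exI[of _ N] exI[of _ "\<lambda>i. x (N - i)"]) auto
  qed
  then show ?thesis by blast
qed

lemma chain_metric_bounds:
  assumes "chain_inequality q K X d" and K: "K > 0" and ab: "a \<in> X" "b \<in> X"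
  shows "d a b powr q \<le> K * chain_metric q X d a b" "chain_metric q X d a b \<le> d a b powr q"
proof -
  have "d a b powr q / K \<le> s" if "s \<in> chain_sums q X d a b" for s
    using that assms(1) K unfolding chain_sums_def chain_inequality_def
    by (auto simp: divide_le_eq mult.commute)
  then have "d a b powr q / K \<le> Inf (chain_sums q X d a b)"
    using chain_sums_nonempty[OF ab] by (intro cInf_greatest) auto
  then show "d a b powr q \<le> K * chain_metric q X d a b"
    using K ab by (simp add: chain_metric_def divide_le_eq mult.commute)
  show "chain_metric q X d a b \<le> d a b powr q"
    using ab single_step_in_chain_sums[OF ab] unfolding chain_metric_def
    by (auto intro: cInf_lower bdd_below_chain_sums)
qed

lemma Metric_space_chain_metric:
  assumes M: "Metric_space X d" and ch: "chain_inequality q K X d" and K: "K > 0"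
  shows "Metric_space X (chain_metric q X d)"
proof
  fix a b c
  show "0 \<le> chain_metric q X d a b"
    using chain_sums_nonempty[of a X b q d] unfolding chain_metric_def
    by (auto intro!: cInf_greatest dest: chain_sums_nonneg)
  show "chain_metric q X d a b = chain_metric q X d b a"
    unfolding chain_metric_def chain_sums_commute[OF M, of q a b] by auto
  assume ab: "a \<in> X" "b \<in> X"
  show "chain_metric q X d a b = 0 \<longleftrightarrow> a = b"
  proof
    assume "chain_metric q X d a b = 0"
    then have "d a b powr q \<le> 0" using chain_metric_bounds(1)[OF ch K ab] by simp
    then have "d a b = 0" by (metis powr_ge_zero antisym powr_eq_0_iff)
    then show "a = b" using ab by (simp add: Metric_space.zero[OF M])
  next
    assume "a = b"
    then have "chain_metric q X d a b \<le> 0"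
      using chain_metric_bounds(2)[OF ch K ab] ab Metric_space.mdist_zero[OF M] by simp
    then show "chain_metric q X d a b = 0" using \<open>0 \<le> chain_metric q X d a b\<close> by simp
  qed
  assume c: "c \<in> X"
  show "chain_metric q X d a c \<le> chain_metric q X d a b + chain_metric q X d b c"
  proof -
    have le: "Inf (chain_sums q X d a c) \<le> s + t"
      if "s \<in> chain_sums q X d a b" "t \<in> chain_sums q X d b c" for s t
      using that by (intro cInf_lower bdd_below_chain_sums chain_sums_add)
    have "Inf (chain_sums q X d a c) - t \<le> Inf (chain_sums q X d a b)"
      if "t \<in> chain_sums q X d b c" for t
      using chain_sums_nonempty[OF ab] le that
      by (intro cInf_greatest) (auto simp: algebra_simps)
    then have "Inf (chain_sums q X d a c) - Inf (chain_sums q X d a b) \<le> Inf (chain_sums q X d b c)"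
      using chain_sums_nonempty[OF ab(2) c]
      by (intro cInf_greatest) (auto simp: algebra_simps)
    then show ?thesis using ab c by (simp add: chain_metric_def)
  qed
qed

text \<open>
  For the triangle inequality, \<open>(a + b)\<^sup>\<alpha> \<le> a\<^sup>\<alpha> + b\<^sup>\<alpha>\<close>: after dividing by \<open>a + b\<close> both numbers lie in
  \<open>[0, 1]\<close>, where \<open>t \<le> t\<^sup>\<alpha>\<close>.
\<close>

lemma Metric_space_powr:
  assumes M: "Metric_space X \<rho>" and \<alpha>: "0 < \<alpha>" "\<alpha> \<le> 1"
  shows "Metric_space X (\<lambda>x y. \<rho> x y powr \<alpha>)"
proof
  interpret Metric_space X \<rho> by (fact M)
  fix x y z
  show "0 \<le> \<rho> x y powr \<alpha>" "\<rho> x y powr \<alpha> = \<rho> y x powr \<alpha>" by (simp_all add: commute)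
  assume xy: "x \<in> X" "y \<in> X"
  then show "\<rho> x y powr \<alpha> = 0 \<longleftrightarrow> x = y" by simp
  assume "z \<in> X"
  then have "\<rho> x z powr \<alpha> \<le> (\<rho> x y + \<rho> y z) powr \<alpha>"
    using xy \<alpha> by (intro powr_mono2 triangle) auto
  also have "\<dots> \<le> \<rho> x y powr \<alpha> + \<rho> y z powr \<alpha>"
  proof (cases "\<rho> x y + \<rho> y z = 0")
    case True
    then show ?thesis by simp
  next
    case False
    define s where "s = \<rho> x y + \<rho> y z"
    have s: "s > 0" using False nonneg[of x y] nonneg[of y z] unfolding s_def by linarith
    have ge: "t / s \<le> (t / s) powr \<alpha>" if "0 \<le> t" "t \<le> s" for t
    proof (cases "t = 0")
      case False
      then have "(t / s) powr 1 \<le> (t / s) powr \<alpha>"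
        using that s \<alpha> by (intro powr_mono') auto
      then show ?thesis using that s by simp
    qed simp
    have "1 = \<rho> x y / s + \<rho> y z / s" using s by (simp add: s_def flip: add_divide_distrib)
    also have "\<dots> \<le> (\<rho> x y / s) powr \<alpha> + (\<rho> y z / s) powr \<alpha>"
      using nonneg by (intro add_mono ge) (auto simp: s_def)
    finally have "s powr \<alpha> * 1 \<le> s powr \<alpha> * ((\<rho> x y / s) powr \<alpha> + (\<rho> y z / s) powr \<alpha>)"
      by (intro mult_left_mono) auto
    then show ?thesis using s by (simp add: s_def[symmetric] powr_divide distrib_left)
  qed
  finally show "\<rho> x z powr \<alpha> \<le> \<rho> x y powr \<alpha> + \<rho> y z powr \<alpha>" .
qed

text \<open>
  The chain metric \<open>\<rho>\<close> is comparable with \<open>d\<^sup>q\<close>, so \<open>d\<close> is comparable with \<open>\<rho>\<^sup>1\<^sup>/\<^sup>q\<close>.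
\<close>

lemma snowflake_if_satisfies_chain_inequality:
  assumes M: "Metric_space X d" and "satisfies_chain_inequality X d"
  shows "bilipschitz_equivalent_to_snowflake X d"
proof -
  obtain q K where q: "q > 1" and K: "K > 0" and ch: "chain_inequality q K X d"
    using assms(2) by (auto simp: satisfies_chain_inequality_def)
  let ?\<rho> = "chain_metric q X d"
  let ?e = "\<lambda>x y. ?\<rho> x y powr (1 / q)"
  have \<rho>: "Metric_space X ?\<rho>" by (rule Metric_space_chain_metric[OF M ch K])
  have nn: "0 \<le> ?\<rho> x y" "0 \<le> d x y" for x y using \<rho> M by (simp_all add: Metric_space.nonneg)
  have e: "Metric_space X ?e" using q by (intro Metric_space_powr[OF \<rho>]) auto
  have sf: "snowflake X ?e"
    unfolding snowflake_def alpha_snowflake_def using q \<rho> by (intro exI[of _ "1 / q"]) auto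
  define C where "C = max 1 (K powr (1 / q))"
  have C: "C \<ge> 1" "K powr (1 / q) \<le> C" by (auto simp: C_def)
  have "inverse C * d x y \<le> ?e x y \<and> ?e x y \<le> C * d x y" if xy: "x \<in> X" "y \<in> X" for x y
  proof
    have dq: "(d x y powr q) powr (1 / q) = d x y" using q nn by (simp add: powr_powr)
    have "(d x y powr q) powr (1 / q) \<le> (K * ?\<rho> x y) powr (1 / q)"
      using chain_metric_bounds(1)[OF ch K xy] q by (intro powr_mono2) auto
    also have "\<dots> = K powr (1 / q) * ?e x y" using K nn by (simp add: powr_mult)
    also have "\<dots> \<le> C * ?e x y" using C by (intro mult_right_mono) auto
    finally show "inverse C * d x y \<le> ?e x y" using C dq by (simp add: field_simps)
    have "?e x y \<le> (d x y powr q) powr (1 / q)"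
      using chain_metric_bounds(2)[OF ch K xy] q nn by (intro powr_mono2) auto
    also have "\<dots> = 1 * d x y" using dq by simp
    also have "\<dots> \<le> C * d x y" using C nn by (intro mult_right_mono) auto
    finally show "?e x y \<le> C * d x y" .
  qed
  then have "bilipschitz_equivalent X d X ?e"
    unfolding bilipschitz_equivalent_def bilipschitz_map_def using C
    by (intro exI[of _ id]) auto
  then show ?thesis unfolding bilipschitz_equivalent_to_snowflake_def using e sf by blast
qed

lemma bilipschitz_equivalent_to_snowflake_iff_chain_inequality:
  assumes M: "Metric_space X d"
  shows "bilipschitz_equivalent_to_snowflake X d \<longleftrightarrow> satisfies_chain_inequality X d"
  using snowflake_if_satisfies_chain_inequality[OF M] satisfies_chain_inequality_snowflake
    satisfies_chain_inequality_bilipschitz_equivalent[OF M]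
  unfolding bilipschitz_equivalent_to_snowflake_def by blast

section \<open>The chain inequality from the absence of almost geodesic chains\<close>

text \<open>The triangle inequality gives this with \<open>\<kappa> = n\<close>; what matters is a smaller \<open>\<kappa>\<close>.\<close>

definition step_contraction :: "nat \<Rightarrow> real \<Rightarrow> 'a set \<Rightarrow> ('a \<Rightarrow> 'a \<Rightarrow> real) \<Rightarrow> bool" where
  "step_contraction n \<kappa> X d \<longleftrightarrow>
     (\<forall>x s. (\<forall>i\<le>n. x i \<in> X) \<longrightarrow> (\<forall>i<n. d (x i) (x (Suc i)) \<le> s) \<longrightarrow> d (x 0) (x n) \<le> \<kappa> * s)"

lemma step_contractionD:
  assumes "step_contraction n \<kappa> X d" "\<And>i. i \<le> n \<Longrightarrow> x i \<in> X" "\<And>i. i < n \<Longrightarrow> d (x i) (x (Suc i)) \<le> s"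
  shows "d (x 0) (x n) \<le> \<kappa> * s"
  using assms unfolding step_contraction_def by blast

text \<open>A chain of \<open>a * b\<close> small steps is a chain of \<open>a\<close> longer steps, each made of \<open>b\<close> small ones.\<close>

lemma step_contraction_mult:
  assumes a: "step_contraction a \<kappa> X d" and b: "step_contraction b \<mu> X d"
  shows "step_contraction (a * b) (\<kappa> * \<mu>) X d"
  unfolding step_contraction_def
proof (intro allI impI)
  fix x s assume x: "\<forall>i\<le>a * b. x i \<in> X" and s: "\<forall>i<a * b. d (x i) (x (Suc i)) \<le> s"
  have le: "i * b + j \<le> a * b" if "i < a" "j \<le> b" for i j
  proof -
    have "i * b + j \<le> Suc i * b" using that by simp
    also have "\<dots> \<le> a * b" using that by (intro mult_le_mono1) simp
    finally show ?thesis .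
  qed
  have "d (x (i * b)) (x (Suc i * b)) \<le> \<mu> * s" if i: "i < a" for i
  proof -
    have "i * b + j < a * b" if "j < b" for j using le[OF i, of "Suc j"] that by simp
    then have "d (x (i * b + 0)) (x (i * b + b)) \<le> \<mu> * s"
      using x s le[OF i] by (intro step_contractionD[OF b, where x = "\<lambda>j. x (i * b + j)"]) auto
    then show ?thesis by (simp add: add.commute)
  qed
  then have "d (x (0 * b)) (x (a * b)) \<le> \<kappa> * (\<mu> * s)"
    using x by (intro step_contractionD[OF a, where x = "\<lambda>i. x (i * b)"]) auto
  then show "d (x 0) (x (a * b)) \<le> \<kappa> * \<mu> * s" by (simp add: mult.assoc)
qed

lemma step_contraction_power:
  assumes "step_contraction n \<kappa> X d"
  shows "step_contraction (n ^ j) (\<kappa> ^ j) X d"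
proof (induction j)
  case 0
  then show ?case by (auto simp: step_contraction_def)
next
  case (Suc j)
  then show ?case using step_contraction_mult[OF assms] by simp
qed

text \<open>
  A chain violating the contraction would be extremal, hence almost geodesic. Since an almost
  geodesic chain can be thinned out to every second point, \<open>N\<close> can be doubled at no cost; having
  \<open>N \<ge> 2\<close> makes the powers of \<open>N\<close> grow.
\<close>

lemma step_contraction_if_no_almost_geodesic_chains:
  assumes M: "Metric_space X d" and no: "\<not> contains_almost_geodesic_chains X d"
  obtains N \<eta> where "N \<ge> 2" "0 < \<eta>" "\<eta> < 1" "step_contraction N ((1 - \<eta>) * real N) X d"
proof -
  obtain N0 \<eta>0 where N0: "N0 \<ge> 1" "\<eta>0 > 0" and no0: "\<And>c x. \<not> almost_geodesic_chain X d N0 \<eta>0 c x"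
    using no unfolding contains_almost_geodesic_chains_def by blast
  define N where "N = 2 * N0"
  define \<eta> where "\<eta> = min \<eta>0 (1/2)"
  have \<eta>: "0 < \<eta>" "\<eta> < 1" "\<eta> \<le> \<eta>0" using N0 by (auto simp: \<eta>_def)
  have noN: "\<not> almost_geodesic_chain X d N \<eta> c x" for c x
  proof
    assume A: "almost_geodesic_chain X d N \<eta> c x"
    have "\<bar>c * d (x (2*i)) (x (2*j)) - \<bar>real i - real j\<bar> / N0\<bar> \<le> \<eta>0" if "i \<le> N0" "j \<le> N0" for i j
    proof -
      have "\<bar>c * d (x (2*i)) (x (2*j)) - \<bar>real (2*i) - real (2*j)\<bar> / N\<bar> \<le> \<eta>"
        using A that unfolding almost_geodesic_chain_def N_def by (meson mult_le_mono2)
      moreover have "\<bar>real (2*i) - real (2*j)\<bar> / N = \<bar>real i - real j\<bar> / N0"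
      proof -
        have "\<bar>real (2*i) - real (2*j)\<bar> = 2 * \<bar>real i - real j\<bar>" by (simp add: abs_if)
        then show ?thesis by (simp add: N_def)
      qed
      ultimately show ?thesis using \<eta> by simp
    qed
    then have "almost_geodesic_chain X d N0 \<eta>0 c (\<lambda>i. x (2 * i))"
      using A by (auto simp: almost_geodesic_chain_def N_def)
    then show False using no0 by blast
  qed
  have "step_contraction N ((1 - \<eta>) * real N) X d"
    unfolding step_contraction_def
  proof (intro allI impI, rule ccontr)
    fix x s
    assume x: "\<forall>i\<le>N. x i \<in> X" and s: "\<forall>i<N. d (x i) (x (Suc i)) \<le> s"
      and long: "\<not> d (x 0) (x N) \<le> (1 - \<eta>) * real N * s"
    have N: "N \<ge> 1" using N0 by (simp add: N_def)
    have "0 \<le> s" using s N Metric_space.nonneg[OF M, of "x 0" "x 1"] by force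
    moreover have "s \<noteq> 0"
    proof
      assume "s = 0"
      then have "d (x 0) (x N) \<le> (real N - real 0) * 0"
        using x s by (intro dist_le_mult_step[OF M]) auto
      then show False using long \<open>s = 0\<close> by simp
    qed
    ultimately have "almost_geodesic_chain X d N \<eta> (1 / (real N * s)) x"
      using x s long N \<eta> by (intro almost_geodesic_chain_if_extremal[OF M]) auto
    then show False using noN by blast
  qed
  then show thesis using that[of N \<eta>] N0 \<eta> by (simp add: N_def)
qed

text \<open>
  A greedy decomposition: take the longest initial block of weight at most \<open>T\<close>, then one more
  step, and continue behind it. A block together with the step after it weighs more than
  \<open>T\<close>, so a total weight of \<open>(j + 1) T\<close> leaves room for at most \<open>j + 1\<close> blocks and \<open>j\<close> separating
  steps. The hops are padded by trivial ones at the end \<open>n\<close>.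
\<close>

lemma coarsen_into_blocks:
  fixes w :: "nat \<Rightarrow> real"
  assumes "m \<le> n" "(\<Sum>i=m..<n. w i) \<le> real (Suc j) * T" "T \<ge> 0"
  obtains y where "y 0 = m" "\<And>i. i \<ge> 2 * j + 1 \<Longrightarrow> y i = n"
    "\<And>i. m \<le> y i \<and> y i \<le> n" "\<And>i. y i \<le> y (Suc i)"
    "\<And>i. y (Suc i) \<le> Suc (y i) \<or> (\<Sum>l=y i..<y (Suc i). w l) \<le> T"
proof -
  have "\<exists>y. y 0 = m \<and> (\<forall>i\<ge>2*j+1. y i = n) \<and> (\<forall>i. m \<le> y i \<and> y i \<le> n) \<and> (\<forall>i. y i \<le> y (Suc i))
      \<and> (\<forall>i. y (Suc i) \<le> Suc (y i) \<or> (\<Sum>l=y i..<y (Suc i). w l) \<le> T)"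
    using assms
  proof (induction j arbitrary: m)
    case 0
    then show ?case by (intro exI[of _ "\<lambda>i. if i = 0 then m else n"]) auto
  next
    case (Suc j)
    define a where "a = Max {a. m \<le> a \<and> a \<le> n \<and> (\<Sum>i=m..<a. w i) \<le> T}"
    have fin: "finite {a. m \<le> a \<and> a \<le> n \<and> (\<Sum>i=m..<a. w i) \<le> T}"
      by (rule finite_subset[of _ "{..n}"]) auto
    have "a \<in> {a. m \<le> a \<and> a \<le> n \<and> (\<Sum>i=m..<a. w i) \<le> T}"
      unfolding a_def using Suc.prems by (intro Max_in fin) auto
    then have a: "m \<le> a" "a \<le> n" "(\<Sum>i=m..<a. w i) \<le> T" by auto
    show ?case
    proof (cases "a = n")
      case True
      then show ?thesis using a by (intro exI[of _ "\<lambda>i. if i = 0 then m else n"]) auto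
    next
      case False
      have "\<not> (\<Sum>i=m..<Suc a. w i) \<le> T"
      proof
        assume "(\<Sum>i=m..<Suc a. w i) \<le> T"
        then have "Suc a \<le> a" using a False unfolding a_def by (intro Max_ge fin) (auto simp: a_def[symmetric])
        then show False by simp
      qed
      moreover have "(\<Sum>i=m..<Suc a. w i) + (\<Sum>i=Suc a..<n. w i) = (\<Sum>i=m..<n. w i)"
        using a False by (intro sum.atLeastLessThan_concat) auto
      ultimately have "(\<Sum>i=Suc a..<n. w i) \<le> real (Suc j) * T"
        using Suc.prems by (simp add: algebra_simps)
      then obtain y where y: "y 0 = Suc a" "\<And>i. i \<ge> 2*j+1 \<Longrightarrow> y i = n" "\<And>i. Suc a \<le> y i \<and> y i \<le> n"
          "\<And>i. y i \<le> y (Suc i)"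
          "\<And>i. y (Suc i) \<le> Suc (y i) \<or> (\<Sum>l=y i..<y (Suc i). w l) \<le> T"
        using Suc.IH[of "Suc a"] a False Suc.prems by force
      define z where "z i = (case i of 0 \<Rightarrow> m | Suc 0 \<Rightarrow> a | Suc (Suc i) \<Rightarrow> y i)" for i
      have z: "z 0 = m" "z (Suc 0) = a" "\<And>i. z (Suc (Suc i)) = y i" by (auto simp: z_def)
      have split: "\<And>P. P 0 \<Longrightarrow> P (Suc 0) \<Longrightarrow> (\<And>i. P (Suc (Suc i))) \<Longrightarrow> \<forall>i. P i"
        by (metis not0_implies_Suc)
      show ?thesis
      proof (intro exI[of _ z] conjI)
        show "z 0 = m" by (fact z)
        show "\<forall>i\<ge>2 * Suc j + 1. z i = n"
          by (rule split) (auto simp: z y)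
        show "\<forall>i. m \<le> z i \<and> z i \<le> n"
          by (rule split) (use a y(3) in \<open>auto simp: z intro: le_trans Suc_leD\<close>)
        show "\<forall>i. z i \<le> z (Suc i)"
          by (rule split) (use a y in \<open>auto simp: z\<close>)
        show "\<forall>i. z (Suc i) \<le> Suc (z i) \<or> (\<Sum>l=z i..<z (Suc i). w l) \<le> T"
          by (rule split) (use a y in \<open>auto simp: z\<close>)
      qed
    qed
  qed
  then show thesis using that by blast
qed

text \<open>
  Let \<open>S\<close> be the weight of a chain. Cut it into \<open>B\<close> blocks of weight at most \<open>S / B\<close>, separated by
  single steps. By induction the ends of a block are at distance at most
  \<open>(B \<cdot> S / B)\<^sup>1\<^sup>/\<^sup>q = S\<^sup>1\<^sup>/\<^sup>q\<close>, which bounds a single step as well; the constant \<open>B\<close> of the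
  chain inequality is chosen to make the two bounds agree. So at most \<open>2 B - 1\<close> hops of size \<open>S\<^sup>1\<^sup>/\<^sup>q\<close> are left, to which the
  contraction applies.
\<close>

lemma chain_inequality_if_step_contraction:
  assumes M: "Metric_space X d" and contr: "step_contraction n \<kappa> X d"
    and n: "2 * B \<le> n" and B: "B \<ge> 2" and \<kappa>: "\<kappa> \<ge> 0" "\<kappa> \<le> real B powr (1 / q)" and q: "q > 0"
  shows "chain_inequality q (real B) X d"
proof -
  let ?w = "\<lambda>x i. d (x i) (x (Suc i)) powr q"
  have main: "d (x a) (x b) powr q \<le> B * (\<Sum>i=a..<b. ?w x i)"
    if "a \<le> b" and x: "\<And>i. a \<le> i \<Longrightarrow> i \<le> b \<Longrightarrow> x i \<in> X" for x a b
    using that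
  proof (induction "b - a" arbitrary: a b rule: less_induct)
    case less
    define S where "S = (\<Sum>i=a..<b. ?w x i)"
    have S0: "S \<ge> 0" unfolding S_def by (intro sum_nonneg) auto
    show ?case
    proof (cases "S = 0")
      case True
      then have "?w x i = 0" if "a \<le> i" "i < b" for i
        using that sum_nonneg_eq_0_iff[of "{a..<b}" "?w x"] by (simp add: S_def)
      then have "d (x a) (x b) \<le> (real b - real a) * 0"
        using less.prems by (intro dist_le_mult_step[OF M]) auto
      then show ?thesis using Metric_space.nonneg[OF M, of "x a" "x b"] True by (simp add: S_def)
    next
      case False
      then have S: "S > 0" using S0 by simp
      have "S \<le> real (Suc (B - 1)) * (S / B)" using B by simp
      then obtain y where y0: "y 0 = a" and yn: "\<And>i. i \<ge> 2 * (B - 1) + 1 \<Longrightarrow> y i = b"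
        and yr: "\<And>i. a \<le> y i \<and> y i \<le> b" and ym: "\<And>i. y i \<le> y (Suc i)"
        and ys: "\<And>i. y (Suc i) \<le> Suc (y i) \<or> (\<Sum>l=y i..<y (Suc i). ?w x l) \<le> S / B"
        using coarsen_into_blocks[of a b "?w x" "B - 1" "S / B"] less.prems(1) S unfolding S_def by auto
      have hop: "d (x (y i)) (x (y (Suc i))) powr q \<le> S" for i
      proof -
        consider "y (Suc i) = y i" | "y (Suc i) = Suc (y i)" | "(\<Sum>l=y i..<y (Suc i). ?w x l) \<le> S / B"
          using ys[of i] ym[of i] by linarith
        then show ?thesis
        proof cases
          case 1
          then show ?thesis using S Metric_space.mdist_zero[OF M] less.prems(2) yr by simp
        next
          case 2
          have "y i \<in> {a..<b}" using 2 yr[of i] yr[of "Suc i"] by auto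
          then show ?thesis unfolding 2 S_def
            by (intro member_le_sum) auto
        next
          case 3
          \<comment> \<open>a block of weight \<open>S / B < S\<close> is not the whole chain\<close>
          have "S / B < S" using S B by (simp add: divide_less_eq)
          then have "\<not> (y i = a \<and> y (Suc i) = b)" using 3 by (auto simp: S_def)
          then have "y (Suc i) - y i < b - a" using yr[of i] yr[of "Suc i"] ym[of i] by linarith
          then have "d (x (y i)) (x (y (Suc i))) powr q \<le> B * (\<Sum>l=y i..<y (Suc i). ?w x l)"
            using less.prems yr by (intro less.hyps ym) (meson le_trans)+
          also have "\<dots> \<le> B * (S / B)" using 3 by (intro mult_left_mono) auto
          finally show ?thesis using B by simp
        qed
      qed
      have "d (x (y i)) (x (y (Suc i))) \<le> S powr (1 / q)" for i
      proof -
        have "(d (x (y i)) (x (y (Suc i))) powr q) powr (1 / q) \<le> S powr (1 / q)"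
          using hop q by (intro powr_mono2) auto
        then show ?thesis using q Metric_space.nonneg[OF M] by (simp add: powr_powr)
      qed
      then have "d (x (y 0)) (x (y n)) \<le> \<kappa> * S powr (1 / q)"
        using less.prems(2) yr by (intro step_contractionD[OF contr, where x = "\<lambda>i. x (y i)"]) auto
      also have "\<dots> \<le> B powr (1 / q) * S powr (1 / q)" using \<kappa> by (intro mult_right_mono) auto
      finally have "d (x a) (x b) \<le> (B * S) powr (1 / q)"
        using n B S by (simp add: y0 yn powr_mult)
      then have "d (x a) (x b) powr q \<le> ((B * S) powr (1 / q)) powr q"
        using q Metric_space.nonneg[OF M] by (intro powr_mono2) auto
      then show ?thesis using q S B by (simp add: powr_powr S_def[symmetric])
    qed
  qed
  show ?thesis unfolding chain_inequality_def
    using main[of 0] by (auto simp: atLeast0LessThan)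
qed

text \<open>
  Iterating the contraction makes it better than \<open>n / 4\<close> for some \<open>n = N ^ j\<close>. With \<open>B\<close> about
  \<open>n / 2\<close> blocks, \<open>n / 4 < B\<close> leaves room for an exponent \<open>q > 1\<close> with \<open>n / 4 = B\<^sup>1\<^sup>/\<^sup>q\<close>.
\<close>

lemma chain_inequality_if_no_almost_geodesic_chains:
  assumes M: "Metric_space X d" and no: "\<not> contains_almost_geodesic_chains X d"
  obtains q K where "q > 1" "K > 0" "chain_inequality q K X d"
proof -
  obtain N \<eta> where N: "N \<ge> 2" and \<eta>: "0 < \<eta>" "\<eta> < 1"
    and contr: "step_contraction N ((1 - \<eta>) * real N) X d"
    using step_contraction_if_no_almost_geodesic_chains[OF M no] by blast
  obtain j0 where j0: "(1 - \<eta>) ^ j0 < 1 / 4" using real_arch_pow_inv[of "1/4" "1 - \<eta>"] \<eta> by auto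
  \<comment> \<open>the summand \<open>3\<close> ensures \<open>n \<ge> 8\<close>, hence \<open>n / 4 > 1\<close> and \<open>n / 4 < n div 2\<close>\<close>
  define j where "j = j0 + 3"
  define n where "n = N ^ j"
  have "(1 - \<eta>) ^ j \<le> (1 - \<eta>) ^ j0" unfolding j_def using \<eta> by (intro power_decreasing) auto
  then have j: "(1 - \<eta>) ^ j \<le> 1 / 4" using j0 by simp
  have "2 ^ 3 \<le> (2 :: nat) ^ j" unfolding j_def by (intro power_increasing) auto
  also have "\<dots> \<le> n" unfolding n_def using N by (intro power_mono) auto
  finally have n: "n \<ge> 8" by simp
  have contr': "step_contraction n ((1 - \<eta>) ^ j * real n) X d"
    using step_contraction_power[OF contr, of j] by (simp add: n_def power_mult_distrib)
  define B where "B = n div 2"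
  have B: "B \<ge> 4" "2 * B \<le> n" "real n / 4 < B" using n by (auto simp: B_def)
  define q where "q = ln B / ln (real n / 4)"
  have "ln (real n / 4) > 0" using n by simp
  moreover have "ln (real n / 4) < ln B" using n B by simp
  ultimately have q: "q > 1" by (simp add: q_def)
  have "(1 - \<eta>) ^ j * real n \<le> 1/4 * real n" using j by (intro mult_right_mono) auto
  also have "\<dots> = real B powr (1 / q)"
  proof -
    have "1 / q * ln B = ln (real n / 4)" using B by (simp add: q_def)
    then show ?thesis using B n by (simp add: powr_def)
  qed
  finally have "chain_inequality q (real B) X d"
    using B q \<eta> by (intro chain_inequality_if_step_contraction[OF M contr']) auto
  then show thesis using that[of q "real B"] q B by simp
qed

section \<open>Rectifiable curves and geodesic segments\<close>

lemma pathin_uniformly_continuous: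
  assumes M: "Metric_space Z D" and "pathin (Metric_space.mtopology Z D) \<gamma>" and "e > 0"
  obtains \<delta> where "\<delta> > 0" "\<And>s t. s \<in> {0..1} \<Longrightarrow> t \<in> {0..1} \<Longrightarrow> \<bar>s - t\<bar> < \<delta> \<Longrightarrow> D (\<gamma> s) (\<gamma> t) < e"
proof -
  interpret Metric_space Z D by (fact M)
  let ?I = "submetric euclidean_metric {0..1::real}"
  have "continuous_map (mtopology_of ?I) (mtopology_of (metric (Z, D))) \<gamma>"
    using assms(2) by (simp add: pathin_def mtopology_of_submetric)
  moreover have "compact_space (mtopology_of ?I)"
    by (simp add: mtopology_of_submetric compact_space_subtopology)
  ultimately have "uniformly_continuous_map ?I (metric (Z, D)) \<gamma>"
    by (intro continuous_imp_uniformly_continuous_map conjI)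
  then obtain \<delta> where "\<delta> > 0" "\<And>s t. s \<in> {0..1} \<Longrightarrow> t \<in> {0..1} \<Longrightarrow> dist t s < \<delta> \<Longrightarrow> D (\<gamma> t) (\<gamma> s) < e"
    using \<open>e > 0\<close> unfolding uniformly_continuous_map_def by auto
  then show thesis using that[of \<delta>] by (simp add: dist_real_def)
qed

text \<open>
  Equally spaced points of \<open>[0, t]\<close> are completed to a partition of \<open>[0, 1]\<close> by the point \<open>1\<close>,
  unless \<open>t = 1\<close>.
\<close>

lemma partition_sum_le_curve_length:
  assumes M: "Metric_space Z D" and t: "0 < t" "t \<le> 1" and N: "N > 0"
  shows "ereal (\<Sum>i<N. D (\<gamma> (t * real i / real N)) (\<gamma> (t * real (Suc i) / real N))) \<le> curve_length D \<gamma>"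
proof -
  have part: "ereal (\<Sum>i<K. D (\<gamma> (u i)) (\<gamma> (u (Suc i)))) \<le> curve_length D \<gamma>"
    if "u 0 = 0" "u K = 1" "\<And>i. i < K \<Longrightarrow> u i < u (Suc i)" for u K
    unfolding curve_length_def using that by (intro Sup_upper) blast
  define u where "u i = t * real i / real N" for i
  have mono: "u i < u (Suc i)" for i using t N by (simp add: u_def divide_strict_right_mono)
  show ?thesis
  proof (cases "t = 1")
    case True
    then show ?thesis using part[of u N] mono N by (simp add: u_def)
  next
    case False
    define v where "v i = (if i \<le> N then u i else 1)" for i
    have "ereal (\<Sum>i<Suc N. D (\<gamma> (v i)) (\<gamma> (v (Suc i)))) \<le> curve_length D \<gamma>"
    proof (rule part)
      show "v i < v (Suc i)" if "i < Suc N" for i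
      proof (cases "i = N")
        case True
        then show ?thesis using t N False by (simp add: v_def u_def)
      qed (use that mono[of i] in \<open>auto simp: v_def\<close>)
    qed (auto simp: v_def u_def)
    moreover have "(\<Sum>i<N. D (\<gamma> (v i)) (\<gamma> (v (Suc i)))) = (\<Sum>i<N. D (\<gamma> (u i)) (\<gamma> (u (Suc i))))"
      by (intro sum.cong) (auto simp: v_def)
    ultimately have "ereal ((\<Sum>i<N. D (\<gamma> (u i)) (\<gamma> (u (Suc i)))) + D (\<gamma> (v N)) (\<gamma> (v (Suc N))))
        \<le> curve_length D \<gamma>"
      by simp
    moreover have "0 \<le> D (\<gamma> (v N)) (\<gamma> (v (Suc N)))" by (rule Metric_space.nonneg[OF M])
    ultimately show ?thesis
      unfolding u_def[symmetric] by (elim order_trans[rotated]) simp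
  qed
qed

text \<open>
  On a fine partition the chain inequality turns the length \<open>l\<close> into the bound
  \<open>K e\<^sup>q\<^sup>-\<^sup>1 l\<close>, where \<open>e\<close> bounds the steps; as \<open>q > 1\<close>, this can be made arbitrarily small.
\<close>

lemma no_rectifiable_curve_if_chain_inequality:
  assumes M: "Metric_space Z D" and ch: "chain_inequality q K Z D" and q: "q > 1" and K: "K > 0"
    and \<gamma>: "rectifiable_curve Z D \<gamma>"
  shows "\<not> nonconstant_curve \<gamma>"
proof
  assume "nonconstant_curve \<gamma>"
  then obtain t where t: "t \<in> {0..1}" "\<gamma> t \<noteq> \<gamma> 0"
    unfolding nonconstant_curve_def by metis
  then have t0: "0 < t" "t \<le> 1" by (auto simp: less_le)
  interpret Metric_space Z D by (fact M)
  have path: "pathin mtopology \<gamma>" and fin: "curve_length D \<gamma> < \<infinity>"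
    using \<gamma> by (auto simp: rectifiable_curve_def)
  have inZ: "\<gamma> s \<in> Z" if "s \<in> {0..1}" for s
    using path that by (auto simp: pathin_def continuous_map_def)
  have pos: "D (\<gamma> 0) (\<gamma> t) > 0" using t inZ[of 0] inZ[of t] nonneg[of "\<gamma> 0" "\<gamma> t"]
    by (metis atLeastAtMost_iff less_le order_refl zero zero_le_one)
  have "0 \<le> curve_length D \<gamma>"
    by (rule order_trans[OF _ partition_sum_le_curve_length[OF M, of 1 1]]) auto
  then obtain l where l: "curve_length D \<gamma> = ereal l" "0 \<le> l"
    using fin by (cases "curve_length D \<gamma>") auto
  define A where "A = D (\<gamma> 0) (\<gamma> t) powr q"
  have A: "A > 0" using pos by (simp add: A_def)
  \<comment> \<open>The mesh \<open>e\<close> is chosen such that \<open>K * e powr (q - 1) * l < A\<close>; using \<open>l + 1\<close> avoids dividing by zero.\<close>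
  define e where "e = (A / (K * (l + 1))) powr (1 / (q - 1))"
  have e: "e > 0" "K * (e powr (q - 1) * (l + 1)) = A"
    using A K l q by (simp_all add: e_def powr_powr)
  obtain \<delta> where \<delta>: "\<delta> > 0"
    and close: "\<And>s t. s \<in> {0..1} \<Longrightarrow> t \<in> {0..1} \<Longrightarrow> \<bar>s - t\<bar> < \<delta> \<Longrightarrow> D (\<gamma> s) (\<gamma> t) < e"
    using pathin_uniformly_continuous[OF M path e(1)] by blast
  obtain N where N: "N > 0" "inverse (real N) < \<delta>" using ex_inverse_of_nat_less[OF \<delta>] by blast
  define u where "u i = t * real i / real N" for i
  have u: "u i \<in> {0..1}" if "i \<le> N" for i
  proof -
    have "t * real i \<le> 1 * real N" using that t0 by (intro mult_mono) auto
    then show ?thesis using t0 N by (simp add: u_def)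
  qed
  have step: "D (\<gamma> (u i)) (\<gamma> (u (Suc i))) powr q \<le> e powr (q - 1) * D (\<gamma> (u i)) (\<gamma> (u (Suc i)))"
    if "i < N" for i
  proof -
    have "\<bar>u i - u (Suc i)\<bar> = t * inverse (real N)"
      using t0 N by (simp add: u_def field_simps)
    also have "\<dots> \<le> 1 * inverse (real N)" using t0 by (intro mult_right_mono) auto
    finally have "D (\<gamma> (u i)) (\<gamma> (u (Suc i))) < e"
      using that u N by (intro close) auto
    then have "D (\<gamma> (u i)) (\<gamma> (u (Suc i))) powr (q - 1) \<le> e powr (q - 1)"
      using q by (intro powr_mono2) auto
    then have "D (\<gamma> (u i)) (\<gamma> (u (Suc i))) powr (q - 1) * D (\<gamma> (u i)) (\<gamma> (u (Suc i)))
        \<le> e powr (q - 1) * D (\<gamma> (u i)) (\<gamma> (u (Suc i)))"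
      by (intro mult_right_mono) auto
    moreover have "r powr (q - 1) * r = r powr q" if "0 \<le> r" for r :: real
      using that by (cases "r = 0") (auto simp: powr_mult_base powr_diff)
    ultimately show ?thesis by simp
  qed
  have "D (\<gamma> (u 0)) (\<gamma> (u N)) powr q \<le> K * (\<Sum>i<N. D (\<gamma> (u i)) (\<gamma> (u (Suc i))) powr q)"
  proof -
    have "\<forall>i\<le>N. \<gamma> (u i) \<in> Z" using u inZ by blast
    then show ?thesis using ch unfolding chain_inequality_def
      by (auto dest: spec[of _ "\<lambda>i. \<gamma> (u i)"])
  qed
  then have "A \<le> K * (\<Sum>i<N. D (\<gamma> (u i)) (\<gamma> (u (Suc i))) powr q)"
    using N by (simp add: A_def u_def)
  also have "\<dots> \<le> K * (\<Sum>i<N. e powr (q - 1) * D (\<gamma> (u i)) (\<gamma> (u (Suc i))))"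
    using step K by (intro mult_left_mono sum_mono) auto
  also have "\<dots> = K * (e powr (q - 1) * (\<Sum>i<N. D (\<gamma> (u i)) (\<gamma> (u (Suc i)))))"
    by (simp add: sum_distrib_left)
  also have "\<dots> \<le> K * (e powr (q - 1) * l)"
    using partition_sum_le_curve_length[OF M t0 N(1), of \<gamma>] K l
    by (intro mult_left_mono) (auto simp: u_def)
  also have "\<dots> < K * (e powr (q - 1) * (l + 1))"
    using K e(1) by (intro mult_strict_left_mono) auto
  finally show False using e by simp
qed

lemma rectifiable_if_geodesic:
  assumes "geodesic_segment Z D \<gamma>"
  shows "rectifiable_curve Z D \<gamma>"
proof -
  have geo: "\<And>s t. s \<in> {0..1} \<Longrightarrow> t \<in> {0..1} \<Longrightarrow> D (\<gamma> s) (\<gamma> t) = \<bar>s - t\<bar> * D (\<gamma> 0) (\<gamma> 1)"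
    and path: "pathin (Metric_space.mtopology Z D) \<gamma>"
    using assms unfolding geodesic_segment_def by blast+
  have "(\<Sum>i<N. D (\<gamma> (t i)) (\<gamma> (t (Suc i)))) = D (\<gamma> 0) (\<gamma> 1)"
    if t: "t 0 = 0" "t N = 1" "\<forall>i<N. t i < t (Suc i)" for N t
  proof -
    have mono: "t i \<le> t j" if "i \<le> j" "j \<le> N" for i j
      using that
    proof (induction j rule: dec_induct)
      case (step j)
      then have "t i \<le> t j" "t j < t (Suc j)" using t(3) by simp_all
      then show ?case by linarith
    qed simp
    then have t01: "t i \<in> {0..1}" if "i \<le> N" for i
      using mono[of 0 i] mono[of i N] t that by simp
    have "(\<Sum>i<N. D (\<gamma> (t i)) (\<gamma> (t (Suc i)))) = (\<Sum>i<N. (t (Suc i) - t i) * D (\<gamma> 0) (\<gamma> 1))"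
    proof (intro sum.cong refl)
      fix i assume "i \<in> {..<N}"
      then show "D (\<gamma> (t i)) (\<gamma> (t (Suc i))) = (t (Suc i) - t i) * D (\<gamma> 0) (\<gamma> 1)"
        using geo[OF t01 t01, of i "Suc i"] t(3) by (simp add: less_imp_le)
    qed
    also have "\<dots> = (t N - t 0) * D (\<gamma> 0) (\<gamma> 1)"
      by (simp add: sum_lessThan_telescope flip: sum_distrib_right)
    finally show ?thesis using t by simp
  qed
  then have "curve_length D \<gamma> \<le> ereal (D (\<gamma> 0) (\<gamma> 1))"
    unfolding curve_length_def by (intro Sup_least) auto
  then have "curve_length D \<gamma> < \<infinity>" by (auto intro: le_less_trans)
  then show ?thesis using path by (simp add: rectifiable_curve_def)
qed

section \<open>Ultralimits\<close>

lemma Metric_space_scale: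
  assumes "Metric_space X d" "r > 0"
  shows "Metric_space X (\<lambda>y z. r * d y z)"
proof -
  interpret Metric_space X d by (fact assms)
  show ?thesis
    using assms(2) triangle by unfold_locales (auto simp: commute simp flip: distrib_left)
qed

lemma Metric_space_is_omega_limit:
  assumes \<omega>: "nonprincipal_ultrafilter \<omega>" and M: "Metric_space X d" and "is_omega_limit_of \<omega> X d Z D"
  shows "Metric_space Z D"
proof -
  obtain r x where r: "\<And>n. r n > 0" and x: "\<And>n. x n \<in> X"
    and Z: "Z = omega_limit_space \<omega> (\<lambda>n. X) (\<lambda>n y z. r n * d y z) x"
    and D: "D = omega_limit_dist \<omega> (\<lambda>n y z. r n * d y z)"
    using assms(3) unfolding is_omega_limit_of_def by blast
  show ?thesis unfolding Z D
    by (rule Metric_space_omega_limit[OF \<omega>]) (auto intro: Metric_space_scale M r x)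
qed

lemma omega_finite_ball:
  assumes \<omega>: "nonprincipal_ultrafilter \<omega>" and "finite F" "\<And>a. a \<in> F \<Longrightarrow> \<omega> {n. P a n} = 1"
  shows "\<omega> {n. \<forall>a\<in>F. P a n} = 1"
  using assms(2,3)
proof (induction F rule: finite_induct)
  case empty
  then show ?case using omega_UNIV[OF \<omega>] by simp
next
  case (insert a F)
  then show ?case using omega_conj[OF \<omega>, of "P a" "\<lambda>n. \<forall>a\<in>F. P a n"] by simp
qed

text \<open>
  Finitely many points of an ultralimit are seen, up to an arbitrarily small error, in a single
  rescaled copy of \<open>X\<close>: each of the finitely many distances is approximated for almost all
  indices. Closed scale-invariant conditions on finite configurations therefore pass to ultralimits.
\<close>

lemma omega_limit_finite_approximation:
  assumes \<omega>: "nonprincipal_ultrafilter \<omega>" and M: "Metric_space X d" and lim: "is_omega_limit_of \<omega> X d Z D"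
    and F: "finite F" "F \<subseteq> Z" and e: "e > 0"
  obtains c f where "c > 0" "f ` F \<subseteq> X" "\<And>A B. A \<in> F \<Longrightarrow> B \<in> F \<Longrightarrow> \<bar>c * d (f A) (f B) - D A B\<bar> < e"
proof -
  obtain r x where r: "\<And>n. r n > 0" and x: "\<And>n. x n \<in> X"
    and Z: "Z = omega_limit_space \<omega> (\<lambda>n. X) (\<lambda>n y z. r n * d y z) x"
    and D: "D = omega_limit_dist \<omega> (\<lambda>n y z. r n * d y z)"
    using lim unfolding is_omega_limit_of_def by blast
  let ?Adm = "omega_admissible \<omega> (\<lambda>n. X) (\<lambda>n y z. r n * d y z) x"
  let ?rel = "omega_rel \<omega> (\<lambda>n. X) (\<lambda>n y z. r n * d y z) x"
  have Mr: "Metric_space X (\<lambda>y z. r n * d y z)" for n by (intro Metric_space_scale M r)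
  have "\<exists>y. y \<in> ?Adm \<and> A = ?rel `` {y}" if "A \<in> F" for A
  proof -
    have "A \<in> ?Adm // ?rel" using that F Z unfolding omega_limit_space_def by blast
    then show ?thesis by (blast elim: quotientE)
  qed
  then obtain y where y: "\<And>A. A \<in> F \<Longrightarrow> y A \<in> ?Adm" "\<And>A. A \<in> F \<Longrightarrow> A = ?rel `` {y A}"
    by metis
  have "\<omega> {n. \<bar>r n * d (y A n) (y B n) - D A B\<bar> < e} = 1" if AB: "A \<in> F" "B \<in> F" for A B
  proof -
    have "ereal (D (?rel `` {y A}) (?rel `` {y B})) = omega_lim \<omega> (\<lambda>n. r n * d (y A n) (y B n))"
      unfolding D by (rule omega_limit_dist_classes[OF \<omega> Mr x y(1)[OF AB(1)] y(1)[OF AB(2)]])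
    then have "has_omega_lim \<omega> (\<lambda>n. r n * d (y A n) (y B n)) (ereal (D A B))"
      using omega_lim_eq_iff[OF \<omega>] y(2)[OF AB(1)] y(2)[OF AB(2)] by metis
    then show ?thesis using e by (simp add: has_omega_lim_def)
  qed
  then have "\<omega> {n. \<forall>p\<in>F\<times>F. \<bar>r n * d (y (fst p) n) (y (snd p) n) - D (fst p) (snd p)\<bar> < e} = 1"
    using F by (intro omega_finite_ball[OF \<omega>]) auto
  then obtain n where "\<forall>p\<in>F\<times>F. \<bar>r n * d (y (fst p) n) (y (snd p) n) - D (fst p) (snd p)\<bar> < e"
    using omega_ex[OF \<omega>] by blast
  then show thesis using that[of "r n" "\<lambda>A. y A n"] r y(1)
    by (force simp: omega_admissible_def)
qed

lemma chain_inequality_scale: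
  assumes "chain_inequality q K X d" "c > 0" "Metric_space X d"
  shows "chain_inequality q K X (\<lambda>x y. c * d x y)"
proof -
  have "(c * d x y) powr q = c powr q * d x y powr q" for x y
    using assms by (simp add: powr_mult Metric_space.nonneg)
  then show ?thesis using assms unfolding chain_inequality_def
    by (simp add: mult.left_commute[of K] flip: sum_distrib_left)
qed

lemma chain_inequality_omega_limit:
  assumes \<omega>: "nonprincipal_ultrafilter \<omega>" and M: "Metric_space X d" and lim: "is_omega_limit_of \<omega> X d Z D"
    and ch: "chain_inequality q K X d" and q: "q > 0"
  shows "chain_inequality q K Z D"
  unfolding chain_inequality_def
proof (intro allI impI)
  fix N and z :: "nat \<Rightarrow> _" assume z: "\<forall>i\<le>N. z i \<in> Z"
  have ZM: "Metric_space Z D" by (rule Metric_space_is_omega_limit[OF \<omega> M lim])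
  have "\<exists>c f. c > 0 \<and> f ` z ` {..N} \<subseteq> X \<and>
      (\<forall>i\<le>N. \<forall>j\<le>N. \<bar>c * d (f (z i)) (f (z j)) - D (z i) (z j)\<bar> < inverse (real (Suc n)))" for n
  proof -
    obtain c f where "c > 0" "f ` z ` {..N} \<subseteq> X"
      "\<And>A B. A \<in> z ` {..N} \<Longrightarrow> B \<in> z ` {..N} \<Longrightarrow> \<bar>c * d (f A) (f B) - D A B\<bar> < inverse (real (Suc n))"
      using omega_limit_finite_approximation[OF \<omega> M lim, of "z ` {..N}" "inverse (real (Suc n))"] z
      by auto
    then show ?thesis by (intro exI[of _ c] exI[of _ f]) auto
  qed
  then obtain c f where c: "\<And>n. c n > 0" and f: "\<And>n. f n ` z ` {..N} \<subseteq> X"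
    and approx: "\<And>n i j. i \<le> N \<Longrightarrow> j \<le> N \<Longrightarrow>
      \<bar>c n * d (f n (z i)) (f n (z j)) - D (z i) (z j)\<bar> < inverse (real (Suc n))"
    by metis
  have conv: "(\<lambda>n. (c n * d (f n (z i)) (f n (z j))) powr q) \<longlonglongrightarrow> D (z i) (z j) powr q"
    if "i \<le> N" "j \<le> N" for i j
  proof (rule tendsto_powr2)
    have "(\<lambda>n. c n * d (f n (z i)) (f n (z j)) - D (z i) (z j)) \<longlonglongrightarrow> 0"
      using approx[OF that]
      by (intro Lim_null_comparison[OF _ LIMSEQ_inverse_real_of_nat] always_eventually)
        (auto intro: less_imp_le)
    then show "(\<lambda>n. c n * d (f n (z i)) (f n (z j))) \<longlonglongrightarrow> D (z i) (z j)"
      by (simp add: LIM_zero_iff)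
    show "\<forall>\<^sub>F n in sequentially. 0 \<le> c n * d (f n (z i)) (f n (z j))"
      using c Metric_space.nonneg[OF M] by (simp add: less_imp_le)
  qed (use q in auto)
  show "D (z 0) (z N) powr q \<le> K * (\<Sum>i<N. D (z i) (z (Suc i)) powr q)"
  proof (rule LIMSEQ_le)
    show "(\<lambda>n. (c n * d (f n (z 0)) (f n (z N))) powr q) \<longlonglongrightarrow> D (z 0) (z N) powr q"
      by (rule conv) auto
    show "(\<lambda>n. K * (\<Sum>i<N. (c n * d (f n (z i)) (f n (z (Suc i)))) powr q)) \<longlonglongrightarrow>
        K * (\<Sum>i<N. D (z i) (z (Suc i)) powr q)"
      by (intro tendsto_mult_left tendsto_sum conv) auto
    have "(c n * d (f n (z 0)) (f n (z N))) powr q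
        \<le> K * (\<Sum>i<N. (c n * d (f n (z i)) (f n (z (Suc i)))) powr q)" for n
    proof -
      have "\<forall>i\<le>N. f n (z i) \<in> X" using f[of n] by auto
      then show ?thesis using chain_inequality_scale[OF ch c M, of n]
        unfolding chain_inequality_def by (auto dest: spec[of _ "\<lambda>i. f n (z i)"])
    qed
    then show "\<exists>n0. \<forall>n\<ge>n0. (c n * d (f n (z 0)) (f n (z N))) powr q
        \<le> K * (\<Sum>i<N. (c n * d (f n (z i)) (f n (z (Suc i)))) powr q)" by blast
  qed
qed

lemma has_omega_lim_if_LIMSEQ:
  assumes \<omega>: "nonprincipal_ultrafilter \<omega>" and "a \<longlonglongrightarrow> l"
  shows "has_omega_lim \<omega> a (ereal l)"
proof -
  have "\<omega> {n. \<bar>a n - l\<bar> < e} = 1" if e: "e > 0" for e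
  proof -
    obtain n0 where "\<forall>n\<ge>n0. \<bar>a n - l\<bar> < e" using LIMSEQ_D[OF assms(2) e] by auto
    then have "{n. \<not> \<bar>a n - l\<bar> < e} \<subseteq> {..<n0}"
      by (metis (mono_tags, lifting) lessThan_iff mem_Collect_eq not_le subsetI)
    then have "finite {n. \<not> \<bar>a n - l\<bar> < e}" by (rule finite_subset) simp
    then have "\<omega> {n. \<not> \<bar>a n - l\<bar> < e} = 0"
      using \<omega> unfolding nonprincipal_ultrafilter_def by blast
    then show ?thesis using omega_not[OF \<omega>, of "\<lambda>n. \<bar>a n - l\<bar> < e"] by auto
  qed
  then show ?thesis by (simp add: has_omega_lim_def)
qed

lemma geodesic_segment_if_isometric:
  assumes M: "Metric_space Z D" and inZ: "\<And>t. t \<in> {0..1} \<Longrightarrow> \<gamma> t \<in> Z"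
    and iso: "\<And>s t. s \<in> {0..1} \<Longrightarrow> t \<in> {0..1} \<Longrightarrow> D (\<gamma> s) (\<gamma> t) = \<bar>s - t\<bar>"
  shows "geodesic_segment Z D \<gamma>" "nonconstant_curve \<gamma>"
proof -
  interpret Metric_space Z D by (fact M)
  have "pathin mtopology \<gamma>"
    unfolding pathin_def continuous_map_to_metric
  proof (intro ballI allI impI)
    fix t e :: real assume t: "t \<in> topspace (top_of_set {0..1})" and e: "e > 0"
    show "\<exists>U. openin (top_of_set {0..1}) U \<and> t \<in> U \<and> (\<forall>s\<in>U. \<gamma> s \<in> mball (\<gamma> t) e)"
      using t e inZ iso
      by (intro exI[of _ "{0..1} \<inter> ball t e"])
        (auto simp: openin_open_Int dist_real_def)
  qed
  then show "geodesic_segment Z D \<gamma>" unfolding geodesic_segment_def using iso by simp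
  show "nonconstant_curve \<gamma>"
    using iso[of 0 1] iso[of 0 0] unfolding nonconstant_curve_def
    by (intro bexI[of _ 0] bexI[of _ 1]) auto
qed

text \<open>
  Take ever longer and better chains, rescaled to unit length, and let \<open>\<gamma> t\<close> be the class of the
  sequence of points at the position \<open>t\<close> of the chains, rounded down to the grid. Both the
  distortion and the rounding error vanish in the limit, so \<open>\<gamma>\<close> is an isometric embedding of
  \<open>[0, 1]\<close>.
\<close>

lemma omega_limit_contains_geodesic_if_almost_geodesic_chains:
  assumes \<omega>: "nonprincipal_ultrafilter \<omega>" and M: "Metric_space X d"
    and chains: "contains_almost_geodesic_chains X d"
  shows "\<not> no_omega_limit_contains_geodesic \<omega> X d"
proof -
  have "\<exists>c x. almost_geodesic_chain X d (Suc n) (inverse (real (Suc n))) c x" for n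
    using chains unfolding contains_almost_geodesic_chains_def by simp
  then obtain r x where rx: "\<And>n. almost_geodesic_chain X d (Suc n) (inverse (real (Suc n))) (r n) (x n)"
    by metis
  have r: "r n > 0" and x: "i \<le> Suc n \<Longrightarrow> x n i \<in> X" for n i
    using rx[of n] by (auto simp: almost_geodesic_chain_def)
  define p where "p = (\<lambda>n. x n 0)"
  have p: "p n \<in> X" for n by (simp add: p_def x)
  define d' where "d' = (\<lambda>n y z. r n * d y z)"
  have Mr: "Metric_space X (d' n)" for n unfolding d'_def by (intro Metric_space_scale M r)
  define k where "k t n = nat \<lfloor>t * real (Suc n)\<rfloor>" for t n
  \<comment> \<open>The value outside \<open>[0, 1]\<close> only serves to keep \<open>y t n\<close> in \<open>X\<close>.\<close>
  define y where "y t n = (if t \<in> {0..1} then x n (k t n) else p n)" for t n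
  have k: "k t n \<le> Suc n" "\<bar>real (k t n) / real (Suc n) - t\<bar> \<le> inverse (real (Suc n))"
    if t: "t \<in> {0..1}" for t n
  proof -
    have "t * real (Suc n) \<le> 1 * real (Suc n)" using t by (intro mult_right_mono) auto
    then have "\<lfloor>t * real (Suc n)\<rfloor> \<le> \<lfloor>real (Suc n)\<rfloor>" by (intro floor_mono) (simp only: mult_1)
    also have "\<dots> = int (Suc n)" by (rule floor_of_nat)
    finally have "\<lfloor>t * real (Suc n)\<rfloor> \<le> int (Suc n)" .
    then show "k t n \<le> Suc n" unfolding k_def by (simp only: nat_le_iff)
    have "0 \<le> t * real (Suc n)" using t by simp
    then have "\<bar>real (k t n) - t * real (Suc n)\<bar> \<le> 1" unfolding k_def by linarith
    then have "\<bar>real (k t n) - t * real (Suc n)\<bar> / real (Suc n) \<le> 1 / real (Suc n)"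
      by (intro divide_right_mono) auto
    moreover have "\<bar>real (k t n) - t * real (Suc n)\<bar> / real (Suc n) = \<bar>real (k t n) / real (Suc n) - t\<bar>"
    proof -
      have "real (k t n) / real (Suc n) - t = (real (k t n) - t * real (Suc n)) / real (Suc n)"
        by (simp add: diff_divide_distrib del: of_nat_Suc)
      then show ?thesis by (simp del: of_nat_Suc)
    qed
    ultimately show "\<bar>real (k t n) / real (Suc n) - t\<bar> \<le> inverse (real (Suc n))"
      by (simp add: inverse_eq_divide)
  qed
  have yX: "y t n \<in> X" for t n by (auto simp: y_def p k intro: x)
  have lim: "omega_lim \<omega> (\<lambda>n. d' n (y s n) (y t n)) = ereal \<bar>s - t\<bar>"
    if st: "s \<in> {0..1}" "t \<in> {0..1}" for s t
    unfolding omega_lim_eq_iff[OF \<omega>]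
  proof (rule has_omega_lim_if_LIMSEQ[OF \<omega>])
    have near: "\<bar>d' n (y s n) (y t n) - \<bar>s - t\<bar>\<bar> \<le> 3 * inverse (real (Suc n))" for n
    proof -
      have "\<bar>d' n (y s n) (y t n) - \<bar>real (k s n) - real (k t n)\<bar> / real (Suc n)\<bar> \<le> inverse (real (Suc n))"
        using rx[of n] k[OF st(1)] k[OF st(2)] st unfolding almost_geodesic_chain_def d'_def y_def by simp
      moreover have "\<bar>real (k s n) - real (k t n)\<bar> / real (Suc n)
          = \<bar>real (k s n) / real (Suc n) - real (k t n) / real (Suc n)\<bar>"
        by (metis abs_divide abs_of_nat diff_divide_distrib)
      ultimately show ?thesis using k(2)[OF st(1), of n] k(2)[OF st(2), of n] by linarith
    qed
    have "(\<lambda>n. 3 * inverse (real (Suc n))) \<longlonglongrightarrow> 0"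
      using tendsto_mult_left[OF LIMSEQ_inverse_real_of_nat, of 3] by simp
    then have "(\<lambda>n. d' n (y s n) (y t n) - \<bar>s - t\<bar>) \<longlonglongrightarrow> 0"
      by (rule Lim_null_comparison[rotated])
        (intro always_eventually allI, unfold real_norm_def, rule near)
    then show "(\<lambda>n. d' n (y s n) (y t n)) \<longlonglongrightarrow> \<bar>s - t\<bar>" by (simp add: LIM_zero_iff)
  qed
  have y0: "y 0 = p" by (auto simp: y_def k_def p_def)
  have adm: "y t \<in> omega_admissible \<omega> (\<lambda>n. X) d' p" if "t \<in> {0..1}" for t
    using lim[of 0 t] that yX unfolding omega_admissible_def y0 by simp
  define Z where "Z = omega_limit_space \<omega> (\<lambda>n. X) d' p"
  define D where "D = omega_limit_dist \<omega> d'"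
  define \<gamma> where "\<gamma> t = omega_rel \<omega> (\<lambda>n. X) d' p `` {y t}" for t
  have ZD: "is_omega_limit_of \<omega> X d Z D"
    unfolding is_omega_limit_of_def Z_def D_def d'_def using r p by blast
  have "Metric_space Z D" by (rule Metric_space_is_omega_limit[OF \<omega> M ZD])
  moreover have "\<gamma> t \<in> Z" if "t \<in> {0..1}" for t
    unfolding Z_def omega_limit_space_def \<gamma>_def using adm[OF that] by (rule quotientI)
  moreover have "D (\<gamma> s) (\<gamma> t) = \<bar>s - t\<bar>" if "s \<in> {0..1}" "t \<in> {0..1}" for s t
    using omega_limit_dist_classes[OF \<omega> Mr p adm[OF that(1)] adm[OF that(2)]] lim[OF that]
    unfolding D_def \<gamma>_def by simp
  ultimately have "geodesic_segment Z D \<gamma>" "nonconstant_curve \<gamma>"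
    using geodesic_segment_if_isometric[of Z D \<gamma>] by blast+
  then show ?thesis unfolding no_omega_limit_contains_geodesic_def using ZD by blast
qed

section \<open>The SRA condition\<close>

text \<open>
  A good almost geodesic chain of \<open>k\<close> points has steps of nearly equal size, and their sum
  exceeds the distance of the ends by too small a factor.
\<close>

lemma no_SRA_if_almost_geodesic_chains:
  assumes M: "Metric_space X d" and chains: "contains_almost_geodesic_chains X d"
  shows "\<not> SRA_for_some X d"
proof
  assume "SRA_for_some X d"
  then obtain k \<epsilon> \<alpha> where k: "k \<ge> 2" and \<epsilon>: "\<epsilon> > 0" and \<alpha>: "\<alpha> > 0" and sra: "SRA k \<epsilon> \<alpha> X d"
    unfolding SRA_for_some_def by blast
  define N where "N = k - 1"
  have N: "N \<ge> 1" "k = Suc N" using k by (auto simp: N_def)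
  \<comment> \<open>The first bound makes the steps equal up to the factor \<open>1 + \<epsilon>\<close>, the second one the chain short.\<close>
  define \<eta> where "\<eta> = min (\<epsilon> / ((2 + \<epsilon>) * N)) (\<alpha> / (2 * (1 + \<alpha> + N)))"
  have \<eta>: "\<eta> > 0" using \<epsilon> \<alpha> N by (simp add: \<eta>_def)
  have "\<eta> \<le> \<epsilon> / ((2 + \<epsilon>) * N)" "\<eta> \<le> \<alpha> / (2 * (1 + \<alpha> + N))" by (auto simp: \<eta>_def)
  then have \<eta>1: "\<eta> * ((2 + \<epsilon>) * N) \<le> \<epsilon>" and \<eta>2: "\<eta> * (2 * (1 + \<alpha> + N)) \<le> \<alpha>"
    using \<epsilon> \<alpha> N by (simp_all add: pos_le_divide_eq)
  obtain c x where c: "c > 0" and x: "\<And>i. i \<le> N \<Longrightarrow> x i \<in> X"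
    and near: "\<And>i j. i \<le> N \<Longrightarrow> j \<le> N \<Longrightarrow> \<bar>c * d (x i) (x j) - \<bar>real i - real j\<bar> / real N\<bar> \<le> \<eta>"
  proof -
    have "\<exists>c x. almost_geodesic_chain X d N \<eta> c x"
      using chains N(1) \<eta> unfolding contains_almost_geodesic_chains_def by blast
    then show ?thesis using that unfolding almost_geodesic_chain_def by blast
  qed
  define w where "w i = d (x (i - 1)) (x i)" for i
  have step: "\<bar>c * w i - 1 / real N\<bar> \<le> \<eta>" if "i \<in> {1..N}" for i
  proof -
    have "i - 1 \<le> N" "real (i - 1) = real i - 1" using that by (auto simp: of_nat_diff)
    then show ?thesis using near[of "i - 1" i] that by (simp add: w_def)
  qed
  let ?W = "w ` {1..N}"
  have W: "finite ?W" "?W \<noteq> {}" using N by auto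
  have "Max ?W \<in> ?W" "Min ?W \<in> ?W" using W by (auto intro: Max_in Min_in)
  then have mx: "c * Max ?W \<le> 1 / N + \<eta>" and mn: "c * Min ?W \<ge> 1 / N - \<eta>"
    using step by (fastforce simp: abs_le_iff)+
  have "\<eta> * (2 + \<epsilon>) \<le> \<epsilon> * (1 / N)"
    using \<eta>1 N by (simp add: pos_le_divide_eq mult.assoc)
  then have "1 / N + \<eta> \<le> (1 + \<epsilon>) * (1 / N - \<eta>)"
    by (simp add: algebra_simps add_divide_distrib)
  also have "\<dots> \<le> (1 + \<epsilon>) * (c * Min ?W)" using mn \<epsilon> by (intro mult_left_mono) auto
  finally have "c * Max ?W \<le> c * ((1 + \<epsilon>) * Min ?W)" using mx by (simp add: mult.left_commute)
  then have "Max ?W \<le> (1 + \<epsilon>) * Min ?W" using c by simp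
  then have "(1 + \<alpha>) * d (x 0) (x N) \<le> (\<Sum>i=1..N. w i)"
  proof -
    have "x (i - 1) \<in> X" if "i \<in> {1..k}" for i using that N(2) by (intro x) auto
    then show ?thesis
      using sra[unfolded SRA_def, rule_format, of "\<lambda>i. x (i - 1)"] \<open>Max ?W \<le> (1 + \<epsilon>) * Min ?W\<close> N(2)
      by (simp add: w_def)
  qed
  then have "c * ((1 + \<alpha>) * d (x 0) (x N)) \<le> (\<Sum>i=1..N. c * w i)"
    using c by (simp flip: sum_distrib_left)
  also have "\<dots> \<le> (\<Sum>i=1..N. 1 / real N + \<eta>)"
    using step by (intro sum_mono) (fastforce simp: abs_le_iff)
  also have "\<dots> = 1 + N * \<eta>" using N by (simp add: distrib_left)
  finally have "(1 + \<alpha>) * (c * d (x 0) (x N)) \<le> 1 + N * \<eta>" by (simp add: mult.left_commute)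
  moreover have "(1 + \<alpha>) * (1 - \<eta>) \<le> (1 + \<alpha>) * (c * d (x 0) (x N))"
    using near[of 0 N] N \<alpha> by (intro mult_left_mono) (auto simp: abs_le_iff)
  ultimately have "(1 + \<alpha>) * (1 - \<eta>) \<le> 1 + N * \<eta>" by linarith
  then show False using \<eta>2 \<alpha> by (simp add: algebra_simps)
qed

text \<open>
  In a chain violating \<open>SRA\<close> with \<open>\<epsilon> = \<alpha> = e\<close>, every step is at least \<open>s / (1 + e)\<close>, where \<open>s\<close> is the
  largest one, and the steps add up to less than \<open>1 + e\<close> times the distance of the ends. So the chain is extremal
  up to the factor \<open>(1 + e)\<^sup>2\<close>.
\<close>

lemma almost_geodesic_chains_if_no_SRA:
  assumes M: "Metric_space X d" and no: "\<not> SRA_for_some X d"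
  shows "contains_almost_geodesic_chains X d"
  unfolding contains_almost_geodesic_chains_def
proof (intro allI impI)
  fix N :: nat and \<eta> :: real assume N: "N \<ge> 1" and \<eta>: "\<eta> > 0"
  define e where "e = \<eta> / 2"
  have e: "e > 0" "\<eta> = 2 * e" using \<eta> by (simp_all add: e_def)
  have "\<not> SRA (Suc N) e e X d" using no N e unfolding SRA_for_some_def by auto
  then obtain x where x: "\<forall>i\<in>{1..Suc N}. x i \<in> X"
    and ratio: "Max ((\<lambda>i. d (x i) (x (i + 1))) ` {1..N}) \<le> (1 + e) * Min ((\<lambda>i. d (x i) (x (i + 1))) ` {1..N})"
    and short: "(\<Sum>i=1..N. d (x i) (x (i + 1))) < (1 + e) * d (x 1) (x (Suc N))"
    unfolding SRA_def not_all not_imp not_le diff_Suc_1 by blast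
  define w where "w i = d (x i) (x (i + 1))" for i
  define s where "s = Max (w ` {1..N})"
  have nn: "0 \<le> d y z" for y z by (rule Metric_space.nonneg[OF M])
  have s: "w i \<le> s" if "i \<in> {1..N}" for i unfolding s_def using that by (intro Max_ge) auto
  have s': "s \<le> (1 + e) * w i" if "i \<in> {1..N}" for i
  proof -
    have "s \<le> (1 + e) * Min (w ` {1..N})" using ratio by (simp add: s_def w_def[abs_def])
    also have "\<dots> \<le> (1 + e) * w i" using that e by (intro mult_left_mono Min_le) auto
    finally show ?thesis .
  qed
  have "N * s = (\<Sum>i=1..N. s)" by simp
  also have "\<dots> \<le> (\<Sum>i=1..N. (1 + e) * w i)" using s' by (intro sum_mono) auto
  also have "\<dots> = (1 + e) * (\<Sum>i=1..N. w i)" by (simp add: sum_distrib_left)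
  also have "\<dots> < (1 + e) * ((1 + e) * d (x 1) (x (Suc N)))"
    using short e by (intro mult_strict_left_mono) (auto simp: w_def)
  finally have long: "N * s < (1 + e) * ((1 + e) * d (x 1) (x (Suc N)))" .
  have "0 \<le> (\<Sum>i=1..N. d (x i) (x (i + 1)))" using nn by (intro sum_nonneg)
  then have "0 < (1 + e) * d (x 1) (x (Suc N))" using short by linarith
  then have pos: "0 < d (x 1) (x (Suc N))" using e by (simp add: zero_less_mult_iff)
  have "d (x (0 + 1)) (x (N + 1)) \<le> (real N - real 0) * s"
    using x s by (intro dist_le_mult_step[OF M, where x = "\<lambda>i. x (i + 1)"]) (auto simp: w_def)
  then have "0 < real N * s" using pos by simp
  then have s0: "s > 0" using N by (simp add: zero_less_mult_iff)
  have "(1 - \<eta>) * N * s \<le> d (x 1) (x (Suc N))"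
  proof (cases "\<eta> \<le> 1")
    case True
    have "(1 - 2 * e) * ((1 + e) * (1 + e)) \<le> 1"
    proof -
      have "(1 - 2 * e) * ((1 + e) * (1 + e)) = 1 - 3 * (e * e) - 2 * (e * e * e)"
        by (simp add: algebra_simps)
      moreover have "0 \<le> e * e" "0 \<le> e * e * e" using e by auto
      ultimately show ?thesis by linarith
    qed
    then have "(1 - \<eta>) * ((1 + e) * (1 + e)) * d (x 1) (x (Suc N)) \<le> 1 * d (x 1) (x (Suc N))"
      unfolding e(2) using nn by (intro mult_right_mono) auto
    moreover have "(1 - \<eta>) * (N * s) \<le> (1 - \<eta>) * ((1 + e) * ((1 + e) * d (x 1) (x (Suc N))))"
      using True long by (intro mult_left_mono) auto
    ultimately show ?thesis by (simp add: mult.assoc)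
  next
    case False
    then have "(1 - \<eta>) * (N * s) \<le> 0" using s0 by (intro mult_nonpos_nonneg) auto
    then show ?thesis using nn[of "x 1" "x (Suc N)"] by (simp add: mult.assoc)
  qed
  then have "almost_geodesic_chain X d N \<eta> (1 / (real N * s)) (\<lambda>i. x (i + 1))"
    using x s \<eta> N s0
    by (intro almost_geodesic_chain_if_extremal[OF M]) (auto simp: w_def)
  then show "\<exists>c x. almost_geodesic_chain X d N \<eta> c x" by blast
qed

section \<open>Line-fitting\<close>

lemma almost_geodesic_chains_if_line_fitting:
  assumes M: "Metric_space X d" and lf: "line_fitting X d"
  shows "contains_almost_geodesic_chains X d"
  unfolding contains_almost_geodesic_chains_def
proof (intro allI impI)
  fix N :: nat and \<eta> :: real assume N: "N \<ge> 1" and \<eta>: "\<eta> > 0"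
  obtain n where n: "n > 0" "inverse (real n) < \<eta> / 2"
    using ex_inverse_of_nat_less[of "\<eta> / 2"] \<eta> by auto
  obtain D c where D: "Metric_space (X <+> {0..1::real}) D"
    and DR: "\<And>s t. s \<in> {0..1} \<Longrightarrow> t \<in> {0..1} \<Longrightarrow> D (Inr s) (Inr t) = \<bar>s - t\<bar>"
    and c: "c > 0" and DL: "\<And>x y. x \<in> X \<Longrightarrow> y \<in> X \<Longrightarrow> D (Inl x) (Inl y) = c * d x y"
    and near: "\<And>t. t \<in> {0..1} \<Longrightarrow> \<exists>x\<in>X. D (Inr t) (Inl x) < 1 / real n"
    using lf n(1) unfolding line_fitting_def by (metis One_nat_def Suc_leI)
  define u where "u i = real i / real N" for i
  have u: "u i \<in> {0..1}" if "i \<le> N" for i using that N by (simp add: u_def)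
  have "\<exists>x. i \<le> N \<longrightarrow> x \<in> X \<and> D (Inr (u i)) (Inl x) < 1 / real n" for i
    using near u by blast
  then obtain x where x: "\<And>i. i \<le> N \<Longrightarrow> x i \<in> X" "\<And>i. i \<le> N \<Longrightarrow> D (Inr (u i)) (Inl (x i)) < 1 / real n"
    by metis
  have "\<bar>c * d (x i) (x j) - \<bar>real i - real j\<bar> / real N\<bar> \<le> \<eta>" if ij: "i \<le> N" "j \<le> N" for i j
  proof -
    interpret D: Metric_space "X <+> {0..1::real}" D by (fact D)
    let ?a = "Inl (x i) :: 'a + real" and ?b = "Inl (x j) :: 'a + real"
    let ?s = "Inr (u i) :: 'a + real" and ?t = "Inr (u j) :: 'a + real"
    have inD: "?a \<in> X <+> {0..1}" "?b \<in> X <+> {0..1}" "?s \<in> X <+> {0..1}" "?t \<in> X <+> {0..1}"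
      using x(1) u ij by auto
    have "D ?a ?b \<le> D ?a ?s + D ?s ?b" "D ?s ?b \<le> D ?s ?t + D ?t ?b"
      "D ?s ?t \<le> D ?s ?a + D ?a ?t" "D ?a ?t \<le> D ?a ?b + D ?b ?t"
      by (intro D.triangle inD)+
    moreover have "D ?s ?a < 1 / n" "D ?t ?b < 1 / n" using x(2) ij by auto
    ultimately have "\<bar>D ?a ?b - D ?s ?t\<bar> \<le> 2 * inverse n"
      using D.commute[of ?a ?s] D.commute[of ?b ?t] by (simp add: inverse_eq_divide abs_le_iff)
    moreover have "D ?s ?t = \<bar>real i - real j\<bar> / real N"
      using DR[OF u u, OF ij] by (simp add: u_def abs_divide flip: diff_divide_distrib)
    ultimately show ?thesis using n(2) DL x(1) ij by simp
  qed
  then show "\<exists>c x. almost_geodesic_chain X d N \<eta> c x"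
    unfolding almost_geodesic_chain_def using c x(1) by blast
qed

text \<open>
  The interval is glued to \<open>X\<close> along an almost geodesic chain: the distance from \<open>y \<in> X\<close> to
  \<open>t \<in> [0, 1]\<close> is the cheapest way through a pair of a chain point \<open>x\<^sub>i\<close> and its model
  \<open>u\<^sub>i = i / N\<close>, where passing from one to the other costs \<open>\<delta>\<close>. Crossing over and back costs
  \<open>2 \<delta>\<close>, which pays for the distortion of the chain, so the given metrics on both sides are not
  shortened.
\<close>

lemma line_fitting_if_almost_geodesic_chains:
  assumes M: "Metric_space X d" and chains: "contains_almost_geodesic_chains X d"
  shows "line_fitting X d"
  unfolding line_fitting_def
proof (intro allI impI)
  fix n :: nat assume n: "n \<ge> 1"
  interpret Metric_space X d by (fact M)
  define N where "N = 4 * n"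
  define \<delta> where "\<delta> = 1 / (4 * real n)"
  have N: "N \<ge> 1" and \<delta>: "\<delta> > 0" "1 / real N = \<delta>" using n by (simp_all add: N_def \<delta>_def)
  obtain c x where c: "c > 0" and x: "\<And>i. i \<le> N \<Longrightarrow> x i \<in> X"
    and near: "\<And>i j. i \<le> N \<Longrightarrow> j \<le> N \<Longrightarrow> \<bar>c * d (x i) (x j) - \<bar>real i - real j\<bar> / real N\<bar> \<le> 2 * \<delta>"
  proof -
    have "2 * \<delta> > 0" using \<delta>(1) by simp
    then have "\<exists>c x. almost_geodesic_chain X d N (2 * \<delta>) c x"
      using chains N unfolding contains_almost_geodesic_chains_def by blast
    then show ?thesis using that unfolding almost_geodesic_chain_def by blast
  qed
  define u where "u i = real i / real N" for i
  have near': "\<bar>c * d (x i) (x j) - \<bar>u i - u j\<bar>\<bar> \<le> 2 * \<delta>" if "i \<le> N" "j \<le> N" for i j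
    using near[OF that] by (simp add: u_def abs_divide flip: diff_divide_distrib)
  \<comment> \<open>\<open>G y t\<close> is the distance from \<open>y\<close> in \<open>X\<close> to \<open>t\<close> in the interval.\<close>
  define G where "G y t = Min ((\<lambda>i. c * d y (x i) + \<bar>u i - t\<bar>) ` {..N}) + \<delta>" for y t
  have G_le: "G y t \<le> c * d y (x i) + \<bar>u i - t\<bar> + \<delta>" if "i \<le> N" for y t i
    unfolding G_def using that by (intro add_right_mono Min_le) auto
  have G_ex: "\<exists>i\<le>N. G y t = c * d y (x i) + \<bar>u i - t\<bar> + \<delta>" for y t
  proof -
    have "Min ((\<lambda>i. c * d y (x i) + \<bar>u i - t\<bar>) ` {..N}) \<in> (\<lambda>i. c * d y (x i) + \<bar>u i - t\<bar>) ` {..N}"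
      by (intro Min_in) auto
    then obtain i where "Min ((\<lambda>i. c * d y (x i) + \<bar>u i - t\<bar>) ` {..N}) = c * d y (x i) + \<bar>u i - t\<bar>"
      "i \<in> {..N}" by (rule imageE)
    then show ?thesis unfolding G_def by (intro exI[of _ i]) simp
  qed
  have cd: "c * d y z \<le> c * d y w + c * d w z" if "y \<in> X" "z \<in> X" "w \<in> X" for y z w
    using triangle[OF that(1,3,2)] c by (simp flip: distrib_left)
  have cd0: "0 \<le> c * d y z" for y z using c by simp
  have Gpos: "G y t > 0" for y t
    using G_ex[of y t] cd0 \<delta> by (metis abs_ge_zero add_nonneg_nonneg add_nonneg_pos)
  have GX: "G y t \<le> c * d y z + G z t" if "y \<in> X" "z \<in> X" for y z t
  proof -
    obtain i where i: "i \<le> N" "G z t = c * d z (x i) + \<bar>u i - t\<bar> + \<delta>" using G_ex by blast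
    show ?thesis using G_le[OF i(1), of y t] i cd[OF that(1) x[OF i(1)] that(2)] by linarith
  qed
  have GI: "G y s \<le> G y t + \<bar>s - t\<bar>" for y s t
  proof -
    obtain i where i: "i \<le> N" "G y t = c * d y (x i) + \<bar>u i - t\<bar> + \<delta>" using G_ex by blast
    show ?thesis using G_le[OF i(1), of y s] i by linarith
  qed
  have GGX: "c * d y z \<le> G y t + G z t" if "y \<in> X" "z \<in> X" for y z t
  proof -
    obtain i where i: "i \<le> N" "G y t = c * d y (x i) + \<bar>u i - t\<bar> + \<delta>" using G_ex by blast
    obtain j where j: "j \<le> N" "G z t = c * d z (x j) + \<bar>u j - t\<bar> + \<delta>" using G_ex by blast
    have "c * d y z \<le> c * d y (x i) + (c * d (x i) (x j) + c * d (x j) z)"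
      using cd[OF that x[OF i(1)]] cd[OF x[OF i(1)] that(2) x[OF j(1)]] by linarith
    moreover have "c * d (x i) (x j) \<le> \<bar>u i - t\<bar> + \<bar>u j - t\<bar> + 2 * \<delta>"
      using near'[OF i(1) j(1)] by linarith
    ultimately show ?thesis using i j commute[of "x j" z] by simp
  qed
  have GGI: "\<bar>s - t\<bar> \<le> G y s + G y t" if "y \<in> X" for y s t
  proof -
    obtain i where i: "i \<le> N" "G y s = c * d y (x i) + \<bar>u i - s\<bar> + \<delta>" using G_ex by blast
    obtain j where j: "j \<le> N" "G y t = c * d y (x j) + \<bar>u j - t\<bar> + \<delta>" using G_ex by blast
    have "c * d (x i) (x j) \<le> c * d y (x i) + c * d y (x j)"
      using cd[OF x[OF i(1)] x[OF j(1)] that] commute[of "x i" y] by simp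
    then show ?thesis using near'[OF i(1) j(1)] i j by linarith
  qed
  define D :: "'a + real \<Rightarrow> 'a + real \<Rightarrow> real" where
    "D p q = (case (p, q) of (Inl y, Inl z) \<Rightarrow> c * d y z | (Inl y, Inr t) \<Rightarrow> G y t
       | (Inr s, Inl z) \<Rightarrow> G z s | (Inr s, Inr t) \<Rightarrow> \<bar>s - t\<bar>)" for p q
  have D: "D (Inl y) (Inl z) = c * d y z" "D (Inl y) (Inr t) = G y t"
    "D (Inr t) (Inl y) = G y t" "D (Inr s) (Inr t) = \<bar>s - t\<bar>" for y z s t
    by (simp_all add: D_def)
  have MD: "Metric_space (X <+> {0..1}) D"
  proof
    fix p q r :: "'a + real"
    show "0 \<le> D p q" using cd0 Gpos by (cases p; cases q) (auto simp: D less_imp_le)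
    show "D p q = D q p" by (cases p; cases q) (auto simp: D commute)
    assume pq: "p \<in> X <+> {0..1}" "q \<in> X <+> {0..1}"
    show "D p q = 0 \<longleftrightarrow> p = q"
      using pq c Gpos by (cases p; cases q) (auto simp: D less_imp_neq[symmetric])
    assume r: "r \<in> X <+> {0..1}"
    show "D p r \<le> D p q + D q r"
    proof (cases p)
      case p: (Inl y)
      show ?thesis
      proof (cases q)
        case q: (Inl z)
        show ?thesis using pq r p q cd[of y _ z] GX[of y z] by (cases r) (auto simp: D)
      next
        case q: (Inr t)
        show ?thesis using pq r p q GGX[of y _ t] GI[of y _ t]
          by (cases r) (auto simp: D abs_minus_commute)
      qed
    next
      case p: (Inr s)
      show ?thesis
      proof (cases q)
        case q: (Inl z)
        show ?thesis using pq r p q GX[of _ z s] GGI[of z s]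
          by (cases r) (auto simp: D commute add.commute)
      next
        case q: (Inr t)
        show ?thesis using pq r p q GI[of _ s t]
          by (cases r) (auto simp: D add.commute)
      qed
    qed
  qed
  have "\<exists>y\<in>X. D (Inr t) (Inl y) < 1 / real n" if t: "t \<in> {0..1}" for t
  proof -
    define i where "i = nat \<lfloor>t * N\<rfloor>"
    have tN: "0 \<le> t * N" "t * N \<le> 1 * N" using t mult_right_mono[of t 1 "real N"] by auto
    have i: "real i \<le> t * N" "t * N \<le> real i + 1" unfolding i_def using tN(1) by linarith+
    have "real i \<le> real N" using i tN by linarith
    then have iN: "i \<le> N" by simp
    have "\<bar>u i - t\<bar> = \<bar>real i - t * N\<bar> / N"
    proof -
      have "u i - t = (real i - t * N) / N" using N by (simp add: u_def field_simps)
      then show ?thesis by simp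
    qed
    also have "\<dots> \<le> 1 / N" using i by (intro divide_right_mono) auto
    finally have "\<bar>u i - t\<bar> \<le> \<delta>" using \<delta>(2) by simp
    then have "G (x i) t \<le> 2 * \<delta>" using G_le[OF iN, of "x i" t] x[OF iN] by simp
    also have "\<dots> < 1 / real n" using n by (simp add: \<delta>_def field_simps)
    finally show ?thesis using x[OF iN] by (auto simp: D)
  qed
  then show "\<exists>(D :: 'a + real \<Rightarrow> 'a + real \<Rightarrow> real) c. Metric_space (X <+> {0..1}) D \<and>
      (\<forall>s\<in>{0..1}. \<forall>t\<in>{0..1}. D (Inr s) (Inr t) = \<bar>s - t\<bar>) \<and>
      c > 0 \<and> (\<forall>x\<in>X. \<forall>y\<in>X. D (Inl x) (Inl y) = c * d x y) \<and>
      (\<forall>t\<in>{0..1}. \<exists>x\<in>X. D (Inr t) (Inl x) < 1 / real n)"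
    using MD c by (intro exI[of _ D] exI[of _ c]) (auto simp: D)
qed

section \<open>The equivalence\<close>

text \<open>
  The chain inequality implies that ultralimits have no non-constant rectifiable curves, hence no such geodesics,
  hence that \<open>X\<close> has no almost geodesic chains, which implies the chain inequality. The
  remaining conditions are each compared with one member of this cycle.
\<close>

lemma snowflake_conditions_iff_chain_inequality:
  assumes M: "Metric_space X d" and \<omega>: "nonprincipal_ultrafilter \<omega>"
  shows "bilipschitz_equivalent_to_snowflake X d \<longleftrightarrow> satisfies_chain_inequality X d"
    and "no_omega_limit_contains_rectifiable_curve \<omega> X d \<longleftrightarrow> satisfies_chain_inequality X d"
    and "no_omega_limit_contains_geodesic \<omega> X d \<longleftrightarrow> satisfies_chain_inequality X d"
    and "SRA_for_some X d \<longleftrightarrow> satisfies_chain_inequality X d"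
    and "\<not> line_fitting X d \<longleftrightarrow> satisfies_chain_inequality X d"
proof -
  have chain_rect: "no_omega_limit_contains_rectifiable_curve \<omega> X d" if chain: "satisfies_chain_inequality X d"
    unfolding no_omega_limit_contains_rectifiable_curve_def
  proof (intro allI impI notI, elim exE conjE)
    fix Z D \<gamma> assume lim: "is_omega_limit_of \<omega> X d Z D"
      and \<gamma>: "rectifiable_curve Z D \<gamma>" "nonconstant_curve \<gamma>"
    obtain q K where q: "q > 1" "K > 0" and ch: "chain_inequality q K X d"
      using chain by (auto simp: satisfies_chain_inequality_def)
    have "chain_inequality q K Z D"
      using q by (intro chain_inequality_omega_limit[OF \<omega> M lim ch]) auto
    then show False
      using no_rectifiable_curve_if_chain_inequality[OF Metric_space_is_omega_limit[OF \<omega> M lim] _ q \<gamma>(1)] \<gamma>(2)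
      by blast
  qed
  have rect_geo: "no_omega_limit_contains_geodesic \<omega> X d"
    if "no_omega_limit_contains_rectifiable_curve \<omega> X d"
    using that rectifiable_if_geodesic
    unfolding no_omega_limit_contains_rectifiable_curve_def no_omega_limit_contains_geodesic_def by blast
  have geo_no_chains: "\<not> contains_almost_geodesic_chains X d" if "no_omega_limit_contains_geodesic \<omega> X d"
    using that omega_limit_contains_geodesic_if_almost_geodesic_chains[OF \<omega> M] by blast
  have no_chains_chain: "satisfies_chain_inequality X d" if no: "\<not> contains_almost_geodesic_chains X d"
    using chain_inequality_if_no_almost_geodesic_chains[OF M no]
    unfolding satisfies_chain_inequality_def by blast
  have iff: "\<not> contains_almost_geodesic_chains X d \<longleftrightarrow> satisfies_chain_inequality X d"
    using chain_rect rect_geo geo_no_chains no_chains_chain by blast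
  show "bilipschitz_equivalent_to_snowflake X d \<longleftrightarrow> satisfies_chain_inequality X d"
    by (rule bilipschitz_equivalent_to_snowflake_iff_chain_inequality[OF M])
  show "no_omega_limit_contains_rectifiable_curve \<omega> X d \<longleftrightarrow> satisfies_chain_inequality X d"
    and "no_omega_limit_contains_geodesic \<omega> X d \<longleftrightarrow> satisfies_chain_inequality X d"
    using chain_rect rect_geo geo_no_chains iff by blast+
  show "SRA_for_some X d \<longleftrightarrow> satisfies_chain_inequality X d"
    using no_SRA_if_almost_geodesic_chains[OF M] almost_geodesic_chains_if_no_SRA[OF M] iff by blast
  show "\<not> line_fitting X d \<longleftrightarrow> satisfies_chain_inequality X d"
    using almost_geodesic_chains_if_line_fitting[OF M] line_fitting_if_almost_geodesic_chains[OF M] iff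
    by blast
qed

theorem theorem3p1:
  fixes X :: "'a set" and d :: "'a \<Rightarrow> 'a \<Rightarrow> real" and \<omega> :: "nat set \<Rightarrow> real"
  assumes "Metric_space X d" and "nonprincipal_ultrafilter \<omega>"
  shows "((bilipschitz_equivalent_to_snowflake X d \<longleftrightarrow> no_omega_limit_contains_rectifiable_curve \<omega> X d) \<and>
          (no_omega_limit_contains_rectifiable_curve \<omega> X d \<longleftrightarrow> no_omega_limit_contains_geodesic \<omega> X d) \<and>
          (no_omega_limit_contains_geodesic \<omega> X d \<longleftrightarrow> SRA_for_some X d) \<and>
          (SRA_for_some X d \<longleftrightarrow> \<not> line_fitting X d)) \<and>
         (\<forall>(Y :: 'b set) d'. Metric_space Y d' \<and> bilipschitz_equivalent X d Y d' \<longrightarrow>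
            (bilipschitz_equivalent_to_snowflake X d \<longleftrightarrow> bilipschitz_equivalent_to_snowflake Y d') \<and>
            (no_omega_limit_contains_rectifiable_curve \<omega> X d \<longleftrightarrow> no_omega_limit_contains_rectifiable_curve \<omega> Y d') \<and>
            (no_omega_limit_contains_geodesic \<omega> X d \<longleftrightarrow> no_omega_limit_contains_geodesic \<omega> Y d') \<and>
            (SRA_for_some X d \<longleftrightarrow> SRA_for_some Y d') \<and>
            (\<not> line_fitting X d \<longleftrightarrow> \<not> line_fitting Y d'))"
proof (rule conjI)
  note X_iff = snowflake_conditions_iff_chain_inequality[OF assms]
  show "(bilipschitz_equivalent_to_snowflake X d \<longleftrightarrow> no_omega_limit_contains_rectifiable_curve \<omega> X d) \<and>
      (no_omega_limit_contains_rectifiable_curve \<omega> X d \<longleftrightarrow> no_omega_limit_contains_geodesic \<omega> X d) \<and>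
      (no_omega_limit_contains_geodesic \<omega> X d \<longleftrightarrow> SRA_for_some X d) \<and>
      (SRA_for_some X d \<longleftrightarrow> \<not> line_fitting X d)"
    unfolding X_iff by simp
  show "\<forall>(Y :: 'b set) d'. Metric_space Y d' \<and> bilipschitz_equivalent X d Y d' \<longrightarrow>
      (bilipschitz_equivalent_to_snowflake X d \<longleftrightarrow> bilipschitz_equivalent_to_snowflake Y d') \<and>
      (no_omega_limit_contains_rectifiable_curve \<omega> X d \<longleftrightarrow> no_omega_limit_contains_rectifiable_curve \<omega> Y d') \<and>
      (no_omega_limit_contains_geodesic \<omega> X d \<longleftrightarrow> no_omega_limit_contains_geodesic \<omega> Y d') \<and>
      (SRA_for_some X d \<longleftrightarrow> SRA_for_some Y d') \<and>
      (\<not> line_fitting X d \<longleftrightarrow> \<not> line_fitting Y d')"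
  proof (intro allI impI)
    fix Y :: "'b set" and d'
    assume Y: "Metric_space Y d' \<and> bilipschitz_equivalent X d Y d'"
    note Y_iff = snowflake_conditions_iff_chain_inequality[OF conjunct1[OF Y] assms(2)]
    have "satisfies_chain_inequality X d \<longleftrightarrow> satisfies_chain_inequality Y d'"
      using Y by (intro satisfies_chain_inequality_bilipschitz_equivalent assms(1)) auto
    then show "(bilipschitz_equivalent_to_snowflake X d \<longleftrightarrow> bilipschitz_equivalent_to_snowflake Y d') \<and>
        (no_omega_limit_contains_rectifiable_curve \<omega> X d \<longleftrightarrow> no_omega_limit_contains_rectifiable_curve \<omega> Y d') \<and>
        (no_omega_limit_contains_geodesic \<omega> X d \<longleftrightarrow> no_omega_limit_contains_geodesic \<omega> Y d') \<and>
        (SRA_for_some X d \<longleftrightarrow> SRA_for_some Y d') \<and>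
        (\<not> line_fitting X d \<longleftrightarrow> \<not> line_fitting Y d')"
      unfolding X_iff Y_iff by simp
  qed
qed

end
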